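(* The set of unsatisfiable schemata in the class $\mathfrak C_h$ is not recursively enumerable.
   Context: Schemata. Fix a countably infinite set of arithmetic variables and a countably infinite set $\mathcal P$ of propositional symbols. Linear arithmetic expressions are built from arithmetic variables and $0,s,+,-$, modulo the usual arithmetic laws. An indexed proposition is $p_a$ with $p\in\mathcal P$ and $a$ a linear arithmetic expression; if $a\in\mathbb Z$ it is called a propositional variable. Schemata form the smallest set such that: $\top,\bot$, $a<b$ ($a,b$ linear arithmetic expressions) and indexed propositions are schemata; schemata are closed under $\vee,\wedge,\neg$; if $\phi$ is a schema not containing $<$, $i$ is an arithmetic variable and $a,b$ are linear arithmetic expressions, then $\bigwedge_{i=a}^b\phi$ and $\bigvee_{i=a}^b\phi$ are schemata (iterations). A variable is bound in $\phi$ if $\phi$ contains an iteration over it, and free (a parameter) if it occurs outside the scope of every iteration over it; no variable is both free and bound, and distinct iterations use distinct variables. Semantics. An interpretation $\mathcal I$ maps every arithmetic variable to an integer and every propositional variable $p_\alpha$ ($\alpha\in\mathbb Z$) to a truth value; $[\![a]\!]_{\mathcal I}$ is the integer value of $a$. $a<b$ is true iff $[\![a]\!]_{\mathcal I}<[\![b]\!]_{\mathcal I}$; $p_a$ has the value $\mathcal I(p_{[\![a]\!]_{\mathcal I}})$; connectives are as usual; $\bigvee_{i=a}^b\phi$ (resp. $\bigwedge_{i=a}^b\phi$) is true in $\mathcal I$ iff $\phi$ is true in $\mathcal I[\alpha/i]$ for some (resp. every) integer $\alpha$ with $[\![a]\!]_{\mathcal I}\le\alpha\le[\![b]\!]_{\mathcal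 I}$. Standing assumption: parameters are always interpreted by natural numbers. A schema is satisfiable iff it is true in some such interpretation, and unsatisfiable otherwise. $\mathfrak C_h$ is the set of schemata $\phi$ such that: $\phi$ contains at most one parameter $n$; every iteration in $\phi$ is of the form $\bigwedge_{i=1}^n\psi$ or $\bigvee_{i=1}^n\psi$, where $\psi$ contains no iteration and every atomic formula in $\psi$ is one of $p_i,p_{2i},p_{i+1},p_{i-1},p_{2i+1},p_{2i-1}$ for some $p\in\mathcal P$; and the atomic formulae occurring in $\phi$ but not in the scope of an iteration are of the form $p_0$ or $p_n$ with $p\in\mathcal P$. *)

theory Defs
  imports Main "HOL-Library.Nat_Bijection"
begin

section \<open>Schemata\<close>

text \<open>Arithmetic variables and propositional symbols are both named by natural numbers.\<close>

datatype aexp = AVar nat | Zero | Succ aexp | Plus aexp aexp | Minus aexp aexp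

primrec aval :: "(nat \<Rightarrow> int) \<Rightarrow> aexp \<Rightarrow> int" where
  "aval \<rho> (AVar x) = \<rho> x"
| "aval \<rho> Zero = 0"
| "aval \<rho> (Succ a) = aval \<rho> a + 1"
| "aval \<rho> (Plus a b) = aval \<rho> a + aval \<rho> b"
| "aval \<rho> (Minus a b) = aval \<rho> a - aval \<rho> b"

text \<open>
  Linear expressions are taken modulo the arithmetic laws. Instead of forming a quotient we work
  with representatives: two of them denote the same linear expression iff they have the same value
  under every assignment, and the semantics and all conditions on schemata below are invariant under
  this relation.
\<close>

definition aeq :: "aexp \<Rightarrow> aexp \<Rightarrow> bool" (infix "\<approx>" 50) where
  "a \<approx> b \<longleftrightarrow> (\<forall>\<rho>. aval \<rho> a = aval \<rho> b)"

text \<open>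
  The variables with a nonzero coefficient in the normal form of \<open>a\<close>; thus \<open>x\<close> does not count as
  occurring in \<open>Minus (AVar x) (AVar x)\<close>.
\<close>

definition avars :: "aexp \<Rightarrow> nat set" where
  "avars a = {x. \<exists>\<rho> v. aval (\<rho>(x := v)) a \<noteq> aval \<rho> a}"

datatype schema =
    Top
  | Bot
  | Less aexp aexp
  | IProp nat aexp
  | Or schema schema
  | And schema schema
  | Neg schema
  | BigAnd nat aexp aexp schema
  | BigOr nat aexp aexp schema

primrec less_free :: "schema \<Rightarrow> bool" where
  "less_free Top \<longleftrightarrow> True"
| "less_free Bot \<longleftrightarrow> True"
| "less_free (Less a b) \<longleftrightarrow> False"
| "less_free (IProp p a) \<longleftrightarrow> True"
| "less_free (Or \<phi> \<psi>) \<longleftrightarrow> less_free \<phi> \<and> less_free \<psi>"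
| "less_free (And \<phi> \<psi>) \<longleftrightarrow> less_free \<phi> \<and> less_free \<psi>"
| "less_free (Neg \<phi>) \<longleftrightarrow> less_free \<phi>"
| "less_free (BigAnd i a b \<phi>) \<longleftrightarrow> less_free \<phi>"
| "less_free (BigOr i a b \<phi>) \<longleftrightarrow> less_free \<phi>"

primrec iteration_bodies_less_free :: "schema \<Rightarrow> bool" where
  "iteration_bodies_less_free Top \<longleftrightarrow> True"
| "iteration_bodies_less_free Bot \<longleftrightarrow> True"
| "iteration_bodies_less_free (Less a b) \<longleftrightarrow> True"
| "iteration_bodies_less_free (IProp p a) \<longleftrightarrow> True"
| "iteration_bodies_less_free (Or \<phi> \<psi>) \<longleftrightarrow>
     iteration_bodies_less_free \<phi> \<and> iteration_bodies_less_free \<psi>"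
| "iteration_bodies_less_free (And \<phi> \<psi>) \<longleftrightarrow>
     iteration_bodies_less_free \<phi> \<and> iteration_bodies_less_free \<psi>"
| "iteration_bodies_less_free (Neg \<phi>) \<longleftrightarrow> iteration_bodies_less_free \<phi>"
| "iteration_bodies_less_free (BigAnd i a b \<phi>) \<longleftrightarrow>
     less_free \<phi> \<and> iteration_bodies_less_free \<phi>"
| "iteration_bodies_less_free (BigOr i a b \<phi>) \<longleftrightarrow>
     less_free \<phi> \<and> iteration_bodies_less_free \<phi>"

text \<open>The bounds of an iteration are outside its scope.\<close>

primrec parameters :: "schema \<Rightarrow> nat set" where
  "parameters Top = {}"
| "parameters Bot = {}"
| "parameters (Less a b) = avars a \<union> avars b"
| "parameters (IProp p a) = avars a"
| "parameters (Or \<phi> \<psi>) = parameters \<phi> \<union> parameters \<psi>"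
| "parameters (And \<phi> \<psi>) = parameters \<phi> \<union> parameters \<psi>"
| "parameters (Neg \<phi>) = parameters \<phi>"
| "parameters (BigAnd i a b \<phi>) = avars a \<union> avars b \<union> (parameters \<phi> - {i})"
| "parameters (BigOr i a b \<phi>) = avars a \<union> avars b \<union> (parameters \<phi> - {i})"

text \<open>The bound variables, listed once per occurrence of an iteration.\<close>

primrec bound_vars :: "schema \<Rightarrow> nat list" where
  "bound_vars Top = []"
| "bound_vars Bot = []"
| "bound_vars (Less a b) = []"
| "bound_vars (IProp p a) = []"
| "bound_vars (Or \<phi> \<psi>) = bound_vars \<phi> @ bound_vars \<psi>"
| "bound_vars (And \<phi> \<psi>) = bound_vars \<phi> @ bound_vars \<psi>"
| "bound_vars (Neg \<phi>) = bound_vars \<phi>"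
| "bound_vars (BigAnd i a b \<phi>) = i # bound_vars \<phi>"
| "bound_vars (BigOr i a b \<phi>) = i # bound_vars \<phi>"

definition wf_schema :: "schema \<Rightarrow> bool" where
  "wf_schema \<phi> \<longleftrightarrow>
     iteration_bodies_less_free \<phi> \<and>
     distinct (bound_vars \<phi>) \<and>
     set (bound_vars \<phi>) \<inter> parameters \<phi> = {}"

section \<open>Semantics\<close>

text \<open>An interpretation consists of \<open>\<rho>\<close> and \<open>I\<close>, where \<open>I p \<alpha>\<close> is the truth value of \<open>p\<^sub>\<alpha>\<close>.\<close>

primrec holds :: "(nat \<Rightarrow> int) \<Rightarrow> (nat \<Rightarrow> int \<Rightarrow> bool) \<Rightarrow> schema \<Rightarrow> bool" where
  "holds \<rho> I Top \<longleftrightarrow> True"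
| "holds \<rho> I Bot \<longleftrightarrow> False"
| "holds \<rho> I (Less a b) \<longleftrightarrow> aval \<rho> a < aval \<rho> b"
| "holds \<rho> I (IProp p a) \<longleftrightarrow> I p (aval \<rho> a)"
| "holds \<rho> I (Or \<phi> \<psi>) \<longleftrightarrow> holds \<rho> I \<phi> \<or> holds \<rho> I \<psi>"
| "holds \<rho> I (And \<phi> \<psi>) \<longleftrightarrow> holds \<rho> I \<phi> \<and> holds \<rho> I \<psi>"
| "holds \<rho> I (Neg \<phi>) \<longleftrightarrow> \<not> holds \<rho> I \<phi>"
| "holds \<rho> I (BigAnd i a b \<phi>) \<longleftrightarrow> (\<forall>\<alpha>\<in>{aval \<rho> a..aval \<rho> b}. holds (\<rho>(i := \<alpha>)) I \<phi>)"
| "holds \<rho> I (BigOr i a b \<phi>) \<longleftrightarrow> (\<exists>\<alpha>\<in>{aval \<rho> a..aval \<rho> b}. holds (\<rho>(i := \<alpha>)) I \<phi>)"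

definition satisfiable :: "schema \<Rightarrow> bool" where
  "satisfiable \<phi> \<longleftrightarrow> (\<exists>\<rho> I. (\<forall>x\<in>parameters \<phi>. \<rho> x \<in> \<nat>) \<and> holds \<rho> I \<phi>)"

abbreviation unsatisfiable :: "schema \<Rightarrow> bool" where
  "unsatisfiable \<phi> \<equiv> \<not> satisfiable \<phi>"

section \<open>The class of schemata\<close>

text \<open>
  \<open>Top\<close> and \<open>Bot\<close> are logical constants, so the conditions on atomic formulae do not concern them.
\<close>

definition body_index :: "nat \<Rightarrow> aexp \<Rightarrow> bool" where
  "body_index i a \<longleftrightarrow>
     (let i1 = AVar i; i2 = Plus (AVar i) (AVar i); one = Succ Zero in
      a \<approx> i1 \<or> a \<approx> i2 \<or> a \<approx> Plus i1 one \<or> a \<approx> Minus i1 one \<or>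
      a \<approx> Plus i2 one \<or> a \<approx> Minus i2 one)"

text \<open>\<open>Ch_body i \<psi>\<close>: \<open>\<psi>\<close> may be the body of an iteration over \<open>i\<close>.\<close>

primrec Ch_body :: "nat \<Rightarrow> schema \<Rightarrow> bool" where
  "Ch_body i Top \<longleftrightarrow> True"
| "Ch_body i Bot \<longleftrightarrow> True"
| "Ch_body i (Less a b) \<longleftrightarrow> False"
| "Ch_body i (IProp p a) \<longleftrightarrow> body_index i a"
| "Ch_body i (Or \<phi> \<psi>) \<longleftrightarrow> Ch_body i \<phi> \<and> Ch_body i \<psi>"
| "Ch_body i (And \<phi> \<psi>) \<longleftrightarrow> Ch_body i \<phi> \<and> Ch_body i \<psi>"
| "Ch_body i (Neg \<phi>) \<longleftrightarrow> Ch_body i \<phi>"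
| "Ch_body i (BigAnd j a b \<phi>) \<longleftrightarrow> False"
| "Ch_body i (BigOr j a b \<phi>) \<longleftrightarrow> False"

text \<open>\<open>Ch_shape n \<phi>\<close>: the iterations and atomic formulae of \<open>\<phi>\<close> are as required for the parameter \<open>n\<close>.\<close>

primrec Ch_shape :: "nat \<Rightarrow> schema \<Rightarrow> bool" where
  "Ch_shape n Top \<longleftrightarrow> True"
| "Ch_shape n Bot \<longleftrightarrow> True"
| "Ch_shape n (Less a b) \<longleftrightarrow> False"
| "Ch_shape n (IProp p a) \<longleftrightarrow> a \<approx> Zero \<or> a \<approx> AVar n"
| "Ch_shape n (Or \<phi> \<psi>) \<longleftrightarrow> Ch_shape n \<phi> \<and> Ch_shape n \<psi>"
| "Ch_shape n (And \<phi> \<psi>) \<longleftrightarrow> Ch_shape n \<phi> \<and> Ch_shape n \<psi>"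
| "Ch_shape n (Neg \<phi>) \<longleftrightarrow> Ch_shape n \<phi>"
| "Ch_shape n (BigAnd i a b \<phi>) \<longleftrightarrow> a \<approx> Succ Zero \<and> b \<approx> AVar n \<and> Ch_body i \<phi>"
| "Ch_shape n (BigOr i a b \<phi>) \<longleftrightarrow> a \<approx> Succ Zero \<and> b \<approx> AVar n \<and> Ch_body i \<phi>"

definition Ch :: "schema set" where
  "Ch = {\<phi>. wf_schema \<phi> \<and> (\<exists>n. parameters \<phi> \<subseteq> {n} \<and> Ch_shape n \<phi>)}"

section \<open>Recursively enumerable sets\<close>

fun primitive_recursion ::
  "(nat list \<Rightarrow> nat option) \<Rightarrow> (nat list \<Rightarrow> nat option) \<Rightarrow> nat \<Rightarrow> nat list \<Rightarrow> nat option" where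
  "primitive_recursion f g 0 xs = f xs"
| "primitive_recursion f g (Suc k) xs =
     Option.bind (primitive_recursion f g k xs) (\<lambda>r. g (k # r # xs))"

definition minimization :: "(nat list \<Rightarrow> nat option) \<Rightarrow> nat list \<Rightarrow> nat option" where
  "minimization f xs =
     (let P = (\<lambda>z. f (z # xs) = Some 0 \<and> (\<forall>y<z. \<exists>v. f (y # xs) = Some (Suc v)))
      in if \<exists>z. P z then Some (LEAST z. P z) else None)"

text \<open>
  \<open>partial_recursive n f\<close>: Kleene's partial recursive functions of arity \<open>n\<close>, with \<open>None\<close> for
  "undefined". Only the values of \<open>f\<close> on lists of length \<open>n\<close> are relevant.
\<close>

inductive partial_recursive :: "nat \<Rightarrow> (nat list \<Rightarrow> nat option) \<Rightarrow> bool" where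
  zero: "partial_recursive n (\<lambda>xs. Some 0)"
| succ: "partial_recursive 1 (\<lambda>xs. Some (Suc (xs ! 0)))"
| proj: "i < n \<Longrightarrow> partial_recursive n (\<lambda>xs. Some (xs ! i))"
| comp: "partial_recursive (length gs) f \<Longrightarrow> \<forall>g\<in>set gs. partial_recursive n g \<Longrightarrow>
    partial_recursive n (\<lambda>xs. Option.bind (those (map (\<lambda>g. g xs) gs)) f)"
| prec: "partial_recursive n f \<Longrightarrow> partial_recursive (Suc (Suc n)) g \<Longrightarrow>
    partial_recursive (Suc n) (\<lambda>xs. primitive_recursion f g (hd xs) (tl xs))"
| mu: "partial_recursive (Suc n) f \<Longrightarrow> partial_recursive n (minimization f)"

definition recursively_enumerable :: "nat set \<Rightarrow> bool" where
  "recursively_enumerable A \<longleftrightarrow>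
     (\<exists>f. partial_recursive 1 f \<and> A = {x. f [x] \<noteq> None})"

text \<open>
  A Goedel numbering. As schemata are represented by terms, a set of schemata is
  enumerated through the codes of all representatives of its members; since \<open>\<approx>\<close> is decidable, this
  is equivalent to enumerating one normal form per schema.
\<close>

primrec aexp_code :: "aexp \<Rightarrow> nat" where
  "aexp_code (AVar x) = prod_encode (0, x)"
| "aexp_code Zero = prod_encode (1, 0)"
| "aexp_code (Succ a) = prod_encode (2, aexp_code a)"
| "aexp_code (Plus a b) = prod_encode (3, prod_encode (aexp_code a, aexp_code b))"
| "aexp_code (Minus a b) = prod_encode (4, prod_encode (aexp_code a, aexp_code b))"

primrec schema_code :: "schema \<Rightarrow> nat" where
  "schema_code Top = prod_encode (0, 0)"
| "schema_code Bot = prod_encode (1, 0)"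
| "schema_code (Less a b) = prod_encode (2, prod_encode (aexp_code a, aexp_code b))"
| "schema_code (IProp p a) = prod_encode (3, prod_encode (p, aexp_code a))"
| "schema_code (Or \<phi> \<psi>) = prod_encode (4, prod_encode (schema_code \<phi>, schema_code \<psi>))"
| "schema_code (And \<phi> \<psi>) = prod_encode (5, prod_encode (schema_code \<phi>, schema_code \<psi>))"
| "schema_code (Neg \<phi>) = prod_encode (6, schema_code \<phi>)"
| "schema_code (BigAnd i a b \<phi>) = prod_encode (7, prod_encode (i,
     prod_encode (aexp_code a, prod_encode (aexp_code b, schema_code \<phi>))))"
| "schema_code (BigOr i a b \<phi>) = prod_encode (8, prod_encode (i,
     prod_encode (aexp_code a, prod_encode (aexp_code b, schema_code \<phi>))))"

lemma aexp_code_inject: "aexp_code a = aexp_code b \<longleftrightarrow> a = b"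
proof (induction a arbitrary: b)
  case (AVar x) then show ?case by (cases b) auto
next
  case Zero then show ?case by (cases b) auto
next
  case (Succ a) then show ?case by (cases b) auto
next
  case (Plus a1 a2) then show ?case by (cases b) auto
next
  case (Minus a1 a2) then show ?case by (cases b) auto
qed

lemma schema_code_inject: "schema_code \<phi> = schema_code \<psi> \<longleftrightarrow> \<phi> = \<psi>"
proof (induction \<phi> arbitrary: \<psi>)
  case Top then show ?case by (cases \<psi>) auto
next
  case Bot then show ?case by (cases \<psi>) auto
next
  case (Less a b) then show ?case by (cases \<psi>) (auto simp: aexp_code_inject)
next
  case (IProp p a) then show ?case by (cases \<psi>) (auto simp: aexp_code_inject)
next
  case (Or \<phi>1 \<phi>2) then show ?case by (cases \<psi>) auto
next
  case (And \<phi>1 \<phi>2) then show ?case by (cases \<psi>) auto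
next
  case (Neg \<phi>) then show ?case by (cases \<psi>) auto
next
  case (BigAnd i a b \<phi>) then show ?case by (cases \<psi>) (auto simp: aexp_code_inject)
next
  case (BigOr i a b \<phi>) then show ?case by (cases \<psi>) (auto simp: aexp_code_inject)
qed

end

(*
  Enumerating the unsatisfiable schemata would enumerate the complement of a halting problem: for a
  program P and an input x there is a schema in Ch that is satisfiable iff P halts on x.

  The programs are nondeterministic counter programs, run on a queue: a store is a word with one
  symbol Reg r per unit of register r and a single End, in any order and interspersed with blanks.
  Every step reads one symbol and appends two. Hence if t_1, t_2, ... are the symbols that ever enter
  the queue, step i reads t_i and appends t_(2i) and t_(2i+1), and the state before step i determines
  the state before step i + 1. A run of n - 1 steps is therefore a truth assignment that satisfies
  local conditions relating the indices i, i + 1, 2i, 2i + 1 for i = 1, ..., n, and "the state before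
  step n is the halting one" is an atom with index n.

  The input enters through a separate iteration, so that the program can be identified with the code
  of the schema describing it, and the map from (code of P, x) to the code of the schema only has to
  compute the code of that iteration.
*)
theory Submission
  imports Defs
begin

section \<open>Counter programs\<close>

text \<open>The index terms of the class dictate the shape of a step: with a queue of length
  \<open>1\<close> before step \<open>1\<close> that grows by one per step, the appended symbols sit
  exactly at \<open>2 * i\<close> and \<open>2 * i + 1\<close>. So every instruction must lengthen
  the queue, which blanks make harmless, and counters are unary and unordered so that rotating the
  queue is enough to change one. Nondeterminism lets a loop guess its number of rounds and a
  rotation guess when to stop; a later test or a missing rule kills the wrong guesses, so programs
  and compiled rules are compared as relations. A model may make additional atoms true. Hence the
  clauses are implications along one run, and each step clause also denies the halting atom at its
  index; otherwise a model could simply assert it at \<open>n\<close>. No undecidability result is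
  taken as given: a procedure semideciding unsatisfiability is itself turned into a counter program,
  whose schema, with its own code as input, would be satisfiable iff it is unsatisfiable.\<close>

type_synonym store = "nat \<Rightarrow> nat"

datatype com =
    Skip
  | Inc nat
  | Dec nat
  | ZeroTest nat
  | Seq com com (infixr \<open>;;\<close> 60)
  | Star com

primrec sem :: "com \<Rightarrow> (store \<times> store) set" where
  "sem Skip = Id"
| "sem (Inc r) = {(s, t). t = s(r := Suc (s r))}"
| "sem (Dec r) = {(s, t). s r \<noteq> 0 \<and> t = s(r := s r - 1)}"
| "sem (ZeroTest r) = {(s, t). s r = 0 \<and> t = s}"
| "sem (c ;; d) = sem c O sem d"
| "sem (Star c) = (sem c)\<^sup>*"

lemma sem_iff:
  "(s, t) \<in> sem Skip \<longleftrightarrow> t = s"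
  "(s, t) \<in> sem (Inc r) \<longleftrightarrow> t = s(r := Suc (s r))"
  "(s, t) \<in> sem (Dec r) \<longleftrightarrow> 0 < s r \<and> t = s(r := s r - 1)"
  "(s, t) \<in> sem (ZeroTest r) \<longleftrightarrow> s r = 0 \<and> t = s"
  "(s, t) \<in> sem (c ;; d) \<longleftrightarrow> (\<exists>u. (s, u) \<in> sem c \<and> (u, t) \<in> sem d)"
  by auto

declare sem.simps [simp del]

text \<open>Along the chain \<open>S 0, S 1, ...\<close> the relation is a partial function with
  guard \<open>P\<close>, so only the chain itself is reachable, as far as the guards permit. The
  assumption is restricted to points whose predecessors passed the guard, since in primitive
  recursion the value at \<open>z\<close> exists only then.\<close>

lemma rtrancl_functional_iff:
  assumes "\<And>z t. (\<And>y. y < z \<Longrightarrow> P y) \<Longrightarrow> (S z, t) \<in> R \<longleftrightarrow> P z \<and> t = S (Suc z)"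
  shows "(S 0, t) \<in> R\<^sup>* \<longleftrightarrow> (\<exists>z. t = S z \<and> (\<forall>y<z. P y))"
proof
  assume "(S 0, t) \<in> R\<^sup>*"
  then show "\<exists>z. t = S z \<and> (\<forall>y<z. P y)"
  proof (induction rule: rtrancl_induct)
    case base
    show ?case by (rule exI[of _ 0]) simp
  next
    case (step t u)
    then obtain z where "t = S z" "\<forall>y<z. P y" by blast
    with step(2) assms[of z u] have "u = S (Suc z)" "\<forall>y<Suc z. P y"
      by (auto simp: less_Suc_eq)
    then show ?case by blast
  qed
next
  have "(\<forall>y<z. P y) \<Longrightarrow> (S 0, S z) \<in> R\<^sup>*" for z
  proof (induction z)
    case (Suc z)
    then have "(S z, S (Suc z)) \<in> R" using assms[of z] by simp
    with Suc show ?case by (auto intro: rtrancl_into_rtrancl)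
  qed simp
  then show "\<exists>z. t = S z \<and> (\<forall>y<z. P y) \<Longrightarrow> (S 0, t) \<in> R\<^sup>*" by blast
qed

text \<open>\<open>Star\<close> guesses the number \<open>z\<close> of rounds. The body admits at
  most \<open>n\<close> of them, and the zero test succeeds only if \<open>n - z = 0\<close>, so the
  one surviving guess is \<open>n\<close>.\<close>

lemma sem_drain:
  assumes body: "\<And>z t. (S z, t) \<in> sem c \<longleftrightarrow> z < n \<and> t = S (Suc z)"
    and S: "\<And>z. S z r = n - z"
  shows "(S 0, t) \<in> sem (Star c ;; ZeroTest r) \<longleftrightarrow> t = S n"
proof -
  have "(S 0, u) \<in> (sem c)\<^sup>* \<longleftrightarrow> (\<exists>z. u = S z \<and> (\<forall>y<z. y < n))" for u
    by (rule rtrancl_functional_iff) (rule body)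
  moreover have "(\<forall>y<z. y < n) \<longleftrightarrow> z \<le> n" for z :: nat
    by (cases z) (auto intro: le_less_trans simp: less_Suc_eq_le Suc_le_eq)
  ultimately have "(S 0, t) \<in> sem (Star c ;; ZeroTest r) \<longleftrightarrow> (\<exists>z\<le>n. t = S z \<and> n - z = 0)"
    using S by (auto simp: sem_iff sem.simps(6))
  then show ?thesis by auto
qed

definition clear :: "nat \<Rightarrow> com" where
  "clear r = Star (Dec r) ;; ZeroTest r"

lemma sem_clear: "(s, t) \<in> sem (clear r) \<longleftrightarrow> t = s(r := 0)"
  using sem_drain[of "\<lambda>z. s(r := s r - z)" "Dec r" "s r" r t]
  by (simp add: clear_def sem_iff)

definition move :: "nat \<Rightarrow> nat \<Rightarrow> com" where
  "move r r' = Star (Dec r ;; Inc r') ;; ZeroTest r"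

lemma sem_move:
  assumes "r \<noteq> r'"
  shows "(s, t) \<in> sem (move r r') \<longleftrightarrow> t = s(r := 0, r' := s r' + s r)"
  using assms sem_drain[of "\<lambda>z. s(r := s r - z, r' := s r' + z)" "Dec r ;; Inc r'" "s r" r t]
  by (simp add: move_def sem_iff fun_upd_twist)

text \<open>Reading a counter empties it, so a second copy is made in the scratch register
  \<open>b\<close> and moved back.\<close>

definition copy :: "nat \<Rightarrow> nat \<Rightarrow> nat \<Rightarrow> com" where
  "copy r r' b = (Star (Dec r ;; Inc r' ;; Inc b) ;; ZeroTest r) ;; move b r"

lemma sem_copy:
  assumes "r \<noteq> r'" "b \<noteq> r" "b \<noteq> r'" "s b = 0"
  shows "(s, t) \<in> sem (copy r r' b) \<longleftrightarrow> t = s(r' := s r' + s r)"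
proof -
  let ?S = "\<lambda>z. s(r := s r - z, r' := s r' + z, b := z)"
  have body: "(?S z, t) \<in> sem (Dec r ;; Inc r' ;; Inc b) \<longleftrightarrow> z < s r \<and> t = ?S (Suc z)" for z t
    using assms by (simp add: sem_iff fun_upd_twist)
  have "(?S 0, u) \<in> sem (Star (Dec r ;; Inc r' ;; Inc b) ;; ZeroTest r) \<longleftrightarrow> u = ?S (s r)" for u
    by (rule sem_drain[of ?S, OF body]) (use assms in simp)
  moreover have "?S 0 = s" using assms by auto
  moreover have "(?S (s r))(b := 0, r := s r) = s(r' := s r' + s r)"
    using assms by auto
  ultimately show ?thesis
    using assms by (simp add: copy_def sem_iff(5)[of _ _ "_ ;; _"] sem_move)
qed

section \<open>Counter programs for the partial recursive functions\<close>

primrec clear_range :: "nat \<Rightarrow> nat \<Rightarrow> com" where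
  "clear_range b 0 = Skip"
| "clear_range b (Suc m) = clear b ;; clear_range (Suc b) m"

lemma sem_clear_range:
  "(s, t) \<in> sem (clear_range b m) \<longleftrightarrow> t = (\<lambda>r. if b \<le> r \<and> r < b + m then 0 else s r)"
proof (induction m arbitrary: b s)
  case (Suc m)
  have "(\<lambda>r. if Suc b \<le> r \<and> r < Suc b + m then 0 else (s(b := 0)) r) =
      (\<lambda>r. if b \<le> r \<and> r < b + Suc m then 0 else s r)"
    by (rule ext) auto
  then show ?case by (simp only: clear_range.simps sem_iff sem_clear Suc) simp
qed (auto simp: sem_iff fun_eq_iff)

text \<open>The final store differs from the initial one at \<open>out\<close> only, so with
  \<open>out\<close> below \<open>b\<close> the scratch registers from \<open>b\<close> on are zero
  again afterwards and programs can be composed. Undefinedness of \<open>f\<close> appears as the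
  absence of a final store.\<close>

definition computes :: "com \<Rightarrow> (nat list \<Rightarrow> nat option) \<Rightarrow> nat list \<Rightarrow> nat \<Rightarrow> nat \<Rightarrow> bool" where
  "computes c f ins out b \<longleftrightarrow>
     (\<forall>s t. (\<forall>r\<ge>b. s r = 0) \<longrightarrow> s out = 0 \<longrightarrow>
       ((s, t) \<in> sem c \<longleftrightarrow> (\<exists>v. f (map s ins) = Some v \<and> t = s(out := v))))"

lemma computesD:
  assumes "computes c f ins out b" "\<And>r. b \<le> r \<Longrightarrow> s r = 0" "s out = 0"
  shows "(s, t) \<in> sem c \<longleftrightarrow> (\<exists>v. f (map s ins) = Some v \<and> t = s(out := v))"
  using assms unfolding computes_def by blast

text \<open>Quantifying over the registers replaces a renaming of programs: each induction
  hypothesis is instantiated where it is needed, with a larger \<open>b\<close> protecting the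
  values still in use.\<close>

definition computable_at :: "(nat list \<Rightarrow> nat option) \<Rightarrow> nat \<Rightarrow> bool" where
  "computable_at f n \<longleftrightarrow>
     (\<forall>ins out b. length ins = n \<longrightarrow> set ins \<subseteq> {..<b} \<longrightarrow> out < b \<longrightarrow> out \<notin> set ins \<longrightarrow>
       (\<exists>c. computes c f ins out b))"

lemma computable_atD:
  assumes "computable_at f n" "length ins = n" "set ins \<subseteq> {..<b}" "out < b" "out \<notin> set ins"
  obtains c where "computes c f ins out b"
  using assms unfolding computable_at_def by blast

primrec write_list :: "nat \<Rightarrow> nat list \<Rightarrow> store \<Rightarrow> store" where
  "write_list b [] s = s"
| "write_list b (v # vs) s = write_list (Suc b) vs (s(b := v))"

lemma write_list_apply:
  "write_list b vs s r = (if b \<le> r \<and> r < b + length vs then vs ! (r - b) else s r)"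
proof (induction vs arbitrary: b s r)
  case (Cons v vs)
  show ?case
  proof (cases "r - b")
    case 0
    then show ?thesis by (auto simp: Cons)
  next
    case (Suc d)
    then have "r = Suc b + d" by simp
    then show ?thesis by (simp add: Cons)
  qed
qed simp

lemma map_write_list: "map (write_list b vs s) [b..<b + length vs] = vs"
  by (rule nth_equalityI) (auto simp: write_list_apply)

lemma map_upd_notin: "r \<notin> set xs \<Longrightarrow> map (s(r := v)) xs = map s xs"
  by auto

text \<open>The induction raises \<open>b\<close> by one per stored value, so that each value lies
  below the scratch area of the programs that follow.\<close>

lemma computes_args:
  assumes "\<forall>g\<in>set gs. computable_at g n" "length ins = n" "set ins \<subseteq> {..<b}"
  shows "\<exists>c. \<forall>s t. (\<forall>r\<ge>b. s r = 0) \<longrightarrow>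
    ((s, t) \<in> sem c \<longleftrightarrow> (\<exists>vs. those (map (\<lambda>g. g (map s ins)) gs) = Some vs \<and> t = write_list b vs s))"
  using assms
proof (induction gs arbitrary: b)
  case Nil
  show ?case by (rule exI[of _ Skip]) (auto simp: sem_iff)
next
  case (Cons g gs)
  from Cons.prems have b: "set ins \<subseteq> {..<Suc b}" "b \<notin> set ins" by auto
  from Cons.prems b obtain c where c: "computes c g ins b (Suc b)"
    using computable_atD[of g n ins "Suc b" b] by auto
  have "\<forall>g\<in>set gs. computable_at g n" using Cons.prems by simp
  from Cons.IH[OF this Cons.prems(2) b(1)] obtain d where
    d: "\<forall>s t. (\<forall>r\<ge>Suc b. s r = 0) \<longrightarrow> ((s, t) \<in> sem d \<longleftrightarrow>
      (\<exists>vs. those (map (\<lambda>g. g (map s ins)) gs) = Some vs \<and> t = write_list (Suc b) vs s))"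
    ..
  have "(s, t) \<in> sem (c ;; d) \<longleftrightarrow>
      (\<exists>vs. those (map (\<lambda>g. g (map s ins)) (g # gs)) = Some vs \<and> t = write_list b vs s)"
    if clean: "\<forall>r\<ge>b. s r = 0" for s t
  proof -
    have "(s, t) \<in> sem (c ;; d) \<longleftrightarrow>
        (\<exists>v. g (map s ins) = Some v \<and> (s(b := v), t) \<in> sem d)"
      unfolding sem_iff(5) using computesD[OF c, of s] clean by auto
    also have "\<dots> \<longleftrightarrow> (\<exists>v vs. g (map s ins) = Some v \<and>
        those (map (\<lambda>g. g (map s ins)) gs) = Some vs \<and> t = write_list (Suc b) vs (s(b := v)))"
      using clean by (simp add: d map_upd_notin[OF b(2)])
    also have "\<dots> \<longleftrightarrow>
        (\<exists>vs. those (map (\<lambda>g. g (map s ins)) (g # gs)) = Some vs \<and> t = write_list b vs s)"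
      by (force split: option.splits)
    finally show ?thesis .
  qed
  then show ?case by blast
qed

lemma computable_at_comp:
  assumes f: "computable_at f (length gs)" and gs: "\<forall>g\<in>set gs. computable_at g n"
  shows "computable_at (\<lambda>xs. Option.bind (those (map (\<lambda>g. g xs) gs)) f) n"
  unfolding computable_at_def
proof (intro allI impI)
  fix ins :: "nat list" and out b :: nat
  assume ins: "length ins = n" "set ins \<subseteq> {..<b}" and out: "out < b" "out \<notin> set ins"
  let ?m = "length gs"
  from computes_args[OF gs ins] obtain d where d: "\<And>s t. (\<forall>r\<ge>b. s r = 0) \<Longrightarrow>
    ((s, t) \<in> sem d \<longleftrightarrow> (\<exists>vs. those (map (\<lambda>g. g (map s ins)) gs) = Some vs \<and> t = write_list b vs s))"
    by blast
  have "length [b..<b + ?m] = ?m" "set [b..<b + ?m] \<subseteq> {..<b + ?m}"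
    "out < b + ?m" "out \<notin> set [b..<b + ?m]"
    using out by auto
  then obtain c where c: "computes c f [b..<b + ?m] out (b + ?m)"
    by (rule computable_atD[OF f])
  have len: "length vs = ?m" if "those (map (\<lambda>g. g xs) gs) = Some vs" for vs xs
    using that by (induction gs arbitrary: vs) (auto split: option.splits)
  have "(s, t) \<in> sem (d ;; c ;; clear_range b ?m) \<longleftrightarrow>
      (\<exists>v. Option.bind (those (map (\<lambda>g. g (map s ins)) gs)) f = Some v \<and> t = s(out := v))"
    if clean: "\<forall>r\<ge>b. s r = 0" and s_out: "s out = 0" for s t
  proof -
    have "(s, t) \<in> sem (d ;; c ;; clear_range b ?m) \<longleftrightarrow>
        (\<exists>vs. those (map (\<lambda>g. g (map s ins)) gs) = Some vs \<and>
          (\<exists>u. (write_list b vs s, u) \<in> sem c \<and> (u, t) \<in> sem (clear_range b ?m)))"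
      unfolding sem_iff(5) using d[of s] clean by auto
    also have "\<dots> \<longleftrightarrow> (\<exists>vs. those (map (\<lambda>g. g (map s ins)) gs) = Some vs \<and>
        (\<exists>v. f vs = Some v \<and> t = s(out := v)))"
    proof -
      have "(\<exists>u. (write_list b vs s, u) \<in> sem c \<and> (u, t) \<in> sem (clear_range b ?m)) \<longleftrightarrow>
        (\<exists>v. f vs = Some v \<and> t = s(out := v))"
        if "those (map (\<lambda>g. g (map s ins)) gs) = Some vs" for vs
      proof -
        let ?w = "write_list b vs s"
        note vs = len[OF that]
        have "map ?w [b..<b + ?m] = vs" using map_write_list[of b vs s] vs by simp
        moreover have "?w r = 0" if "b + ?m \<le> r" for r
          using that clean vs by (simp add: write_list_apply)
        moreover have "?w out = 0" using out(1) s_out by (simp add: write_list_apply)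
        ultimately have c': "(?w, u) \<in> sem c \<longleftrightarrow> (\<exists>v. f vs = Some v \<and> u = ?w(out := v))" for u
          using computesD[OF c, of ?w u] by simp
        \<comment> \<open>The argument registers were zero at the start, so clearing them restores
          everything but \<open>out\<close>.\<close>
        have reset: "(\<lambda>r. if b \<le> r \<and> r < b + ?m then 0 else (?w(out := v)) r) = s(out := v)" for v
          using clean out(1) vs by (intro ext) (simp add: write_list_apply)
        show ?thesis unfolding c' sem_clear_range reset[symmetric] by blast
      qed
      then show ?thesis by (intro ex_cong1) (simp cong: conj_cong)
    qed
    finally show ?thesis unfolding bind_eq_Some_conv by blast
  qed
  then have "computes (d ;; c ;; clear_range b ?m)
      (\<lambda>xs. Option.bind (those (map (\<lambda>g. g xs) gs)) f) ins out b"
    unfolding computes_def by blast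
  then show "\<exists>c. computes c (\<lambda>xs. Option.bind (those (map (\<lambda>g. g xs) gs)) f) ins out b" ..
qed

lemma computable_at_proj: "i < n \<Longrightarrow> computable_at (\<lambda>xs. Some (xs ! i)) n"
  unfolding computable_at_def
proof (intro allI impI)
  fix ins :: "nat list" and out b :: nat
  assume "i < n" "length ins = n" "set ins \<subseteq> {..<b}" "out < b" "out \<notin> set ins"
  then have "ins ! i \<noteq> out" "b \<noteq> ins ! i" "b \<noteq> out" "i < length ins" by (auto dest: nth_mem)
  then have "computes (copy (ins ! i) out b) (\<lambda>xs. Some (xs ! i)) ins out b"
    by (auto simp: computes_def sem_copy)
  then show "\<exists>c. computes c (\<lambda>xs. Some (xs ! i)) ins out b" ..
qed

lemma computable_at_succ: "computable_at (\<lambda>xs. Some (Suc (xs ! 0))) 1"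
  unfolding computable_at_def
proof (intro allI impI)
  fix ins :: "nat list" and out b :: nat
  assume *: "length ins = 1" "set ins \<subseteq> {..<b}" "out < b" "out \<notin> set ins"
  then have "ins ! 0 \<noteq> out" "b \<noteq> ins ! 0" "b \<noteq> out" by (auto simp: length_Suc_conv)
  then have "computes (copy (ins ! 0) out b ;; Inc out) (\<lambda>xs. Some (Suc (xs ! 0))) ins out b"
    using * by (auto simp: computes_def sem_copy sem_iff)
  then show "\<exists>c. computes c (\<lambda>xs. Some (Suc (xs ! 0))) ins out b" ..
qed

lemma minimization_eq_Some_iff:
  "minimization f xs = Some z \<longleftrightarrow> f (z # xs) = Some 0 \<and> (\<forall>y<z. \<exists>v. f (y # xs) = Some (Suc v))"
proof -
  define Q where "Q z \<longleftrightarrow> f (z # xs) = Some 0 \<and> (\<forall>y<z. \<exists>v. f (y # xs) = Some (Suc v))" for z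
  have eq: "minimization f xs = (if \<exists>z. Q z then Some (LEAST z. Q z) else None)"
    unfolding minimization_def Q_def Let_def ..
  have "\<not> z < z'" if "Q z" "Q z'" for z z'
    using that by (force simp: Q_def)
  then have "(LEAST z. Q z) = z" if "Q z" for z
    using that by (intro Least_equality) (auto simp: not_less)
  then have "minimization f xs = Some z \<longleftrightarrow> Q z"
    unfolding eq by auto
  then show ?thesis by (simp add: Q_def)
qed

lemma computable_at_mu:
  assumes f: "computable_at f (Suc n)"
  shows "computable_at (minimization f) n"
  unfolding computable_at_def
proof (intro allI impI)
  fix ins :: "nat list" and out b :: nat
  assume ins: "length ins = n" "set ins \<subseteq> {..<b}" and out: "out < b" "out \<notin> set ins"
  from ins obtain c where c: "computes c f (b # ins) (Suc b) (b + 2)"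
    using computable_atD[OF f, of "b # ins" "b + 2" "Suc b"] by fastforce
  \<comment> \<open>Register \<open>b\<close> holds the candidate, \<open>Suc b\<close> the value of
    \<open>f\<close>. \<open>Dec (Suc b)\<close> doubles as the test that this value is positive: at
    value \<open>0\<close> the body has no final store.\<close>
  let ?body = "c ;; Dec (Suc b) ;; clear (Suc b) ;; Inc b"
  \<comment> \<open>\<open>Star\<close> guesses the minimum, and recomputing \<open>f\<close> with a
    zero test confirms the guess.\<close>
  let ?prog = "Star ?body ;; c ;; ZeroTest (Suc b) ;; move b out"
  have "(s, t) \<in> sem ?prog \<longleftrightarrow> (\<exists>v. minimization f (map s ins) = Some v \<and> t = s(out := v))"
    if clean: "\<forall>r\<ge>b. s r = 0" and s_out: "s out = 0" for s t
  proof -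
    let ?xs = "map s ins"
    let ?P = "\<lambda>z. \<exists>v. f (z # ?xs) = Some (Suc v)"
    have args: "map (s(b := z)) (b # ins) = z # ?xs" for z
      using ins by auto
    have c': "(s(b := z), u) \<in> sem c \<longleftrightarrow>
        (\<exists>v. f (z # ?xs) = Some v \<and> u = s(b := z, Suc b := v))" for z u
      using computesD[OF c, of "s(b := z)" u] clean by (simp add: args del: list.map)
    have "(s(b := 0), u) \<in> (sem ?body)\<^sup>* \<longleftrightarrow> (\<exists>z. u = s(b := z) \<and> (\<forall>y<z. ?P y))" for u
    proof (rule rtrancl_functional_iff)
      fix z u
      have [simp]: "s(b := z', Suc b := 0) = s(b := z')" for z' using clean by (auto simp: fun_eq_iff)
      have "(s(b := z), u) \<in> sem ?body \<longleftrightarrow> (\<exists>v. f (z # ?xs) = Some (Suc v) \<and>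
          u = s(b := z, Suc b := 0, b := Suc z))"
        unfolding sem_iff c' by (auto simp: sem_clear gr0_conv_Suc)
      also have "s(b := z, Suc b := 0, b := Suc z) = s(b := Suc z)"
        using clean by (auto simp: fun_eq_iff)
      finally show "(s(b := z), u) \<in> sem ?body \<longleftrightarrow> ?P z \<and> u = s(b := Suc z)" by blast
    qed
    moreover have "s(b := 0) = s" using clean by (auto simp: fun_eq_iff)
    ultimately have star: "(s, u) \<in> sem (Star ?body) \<longleftrightarrow> (\<exists>z. u = s(b := z) \<and> (\<forall>y<z. ?P y))" for u
      by (simp add: sem.simps(6))
    have "(s, t) \<in> sem ?prog \<longleftrightarrow> (\<exists>z. (\<forall>y<z. ?P y) \<and>
        (\<exists>u. (s(b := z), u) \<in> sem c \<and> u (Suc b) = 0 \<and> (u, t) \<in> sem (move b out)))"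
      unfolding sem_iff(5)[of _ _ "Star ?body"] star sem_iff(5)[of _ _ c]
        sem_iff(5)[of _ _ "ZeroTest _"] sem_iff(4) by blast
    also have "\<dots> \<longleftrightarrow> (\<exists>z. (\<forall>y<z. ?P y) \<and> f (z # ?xs) = Some 0 \<and>
        (s(b := z, Suc b := 0), t) \<in> sem (move b out))"
      unfolding c' by (intro ex_cong1 conj_cong refl) auto
    also have "\<dots> \<longleftrightarrow> (\<exists>z. (\<forall>y<z. ?P y) \<and> f (z # ?xs) = Some 0 \<and> t = s(out := z))"
    proof -
      have "s b = 0" "s (Suc b) = 0" using clean by simp_all
      then have "s(b := z, Suc b := 0, b := 0, out := z) = s(out := z)" for z
        by (intro ext) simp
      then have "(s(b := z, Suc b := 0), t) \<in> sem (move b out) \<longleftrightarrow> t = s(out := z)" for z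
        using sem_move[of b out "s(b := z, Suc b := 0)" t] out(1) s_out by simp
      then show ?thesis by simp
    qed
    also have "\<dots> \<longleftrightarrow> (\<exists>v. minimization f ?xs = Some v \<and> t = s(out := v))"
      unfolding minimization_eq_Some_iff by blast
    finally show ?thesis .
  qed
  then have "computes ?prog (minimization f) ins out b"
    unfolding computes_def by blast
  then show "\<exists>c. computes c (minimization f) ins out b" ..
qed

lemma sem_replace_inc:
  assumes "i \<noteq> cur" "i \<noteq> nxt" "cur \<noteq> nxt"
  shows "(s, t) \<in> sem (clear cur ;; move nxt cur ;; Inc i) \<longleftrightarrow>
    t = s(cur := s nxt, nxt := 0, i := Suc (s i))"
proof -
  have "s(cur := 0, nxt := 0, cur := s nxt) = s(cur := s nxt, nxt := 0)"
    using assms(3) by (intro ext) simp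
  then show ?thesis
    using assms by (simp only: sem_iff sem_clear sem_move[OF assms(3)[symmetric]]) simp
qed

lemma sem_test_clear_move:
  assumes "i \<noteq> cur" "i \<noteq> out" "cur \<noteq> out"
  shows "(s, t) \<in> sem (ZeroTest r ;; clear i ;; move cur out) \<longleftrightarrow>
    s r = 0 \<and> t = s(i := 0, cur := 0, out := s out + s cur)"
  using assms by (simp add: sem_iff sem_clear sem_move)

lemma computable_at_prec:
  assumes f: "computable_at f n" and g: "computable_at g (Suc (Suc n))"
  shows "computable_at (\<lambda>xs. primitive_recursion f g (hd xs) (tl xs)) (Suc n)"
  unfolding computable_at_def
proof (intro allI impI)
  fix ins :: "nat list" and out b :: nat
  assume len: "length ins = Suc n" and ins: "set ins \<subseteq> {..<b}"
    and out: "out < b" "out \<notin> set ins"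
  then obtain k ps where kps: "ins = k # ps" "length ps = n" by (auto simp: length_Suc_conv)
  have k: "k < b" "out \<noteq> k" "k \<noteq> out" and ps: "set ps \<subseteq> {..<b}" "out \<notin> set ps" using kps ins out by auto
  text \<open>Registers \<open>b\<close>, \<open>b + 1\<close>, \<open>b + 2\<close>, \<open>b + 3\<close>: the recursion index, the current value, the next
    value, and the number of remaining rounds.\<close>
  have "set ps \<subseteq> {..<b + 4}" "b + 1 \<notin> set ps" using ps(1) by auto
  then obtain c where c: "computes c f ps (b + 1) (b + 4)"
    using computable_atD[OF f kps(2), of "b + 4" "b + 1"] by auto
  have "set (b # (b + 1) # ps) \<subseteq> {..<b + 4}" "b + 2 \<notin> set (b # (b + 1) # ps)" using ps(1) by auto
  then obtain d where d: "computes d g (b # (b + 1) # ps) (b + 2) (b + 4)"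
    using computable_atD[OF g, of "b # (b + 1) # ps" "b + 4" "b + 2"] kps(2) by auto
  let ?body = "Dec (b + 3) ;; d ;; clear (b + 1) ;; move (b + 2) (b + 1) ;; Inc b"
  let ?prog = "copy k (b + 3) (b + 4) ;; c ;; Star ?body ;; ZeroTest (b + 3) ;; clear b ;; move (b + 1) out"
  have "(s, t) \<in> sem ?prog \<longleftrightarrow>
      (\<exists>v. primitive_recursion f g (s k) (map s ps) = Some v \<and> t = s(out := v))"
    if clean: "\<forall>r\<ge>b. s r = 0" and s_out: "s out = 0" for s t
  proof -
    let ?xs = "map s ps"
    let ?pr = "\<lambda>z. primitive_recursion f g z ?xs"
    let ?S = "\<lambda>z v. s(b := z, b + 1 := v, b + 3 := s k - z)"
    have copy: "(s, u) \<in> sem (copy k (b + 3) (b + 4)) \<longleftrightarrow> u = s(b + 3 := s k)" for u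
      using k clean sem_copy[of k "b + 3" "b + 4" s u] by simp
    have ps_map: "map (s(b + 3 := s k)) ps = ?xs"
      using ps(1) by auto
    have c': "(s(b + 3 := s k), u) \<in> sem c \<longleftrightarrow> (\<exists>v. f ?xs = Some v \<and> u = ?S 0 v)" for u
    proof -
      have "s b = 0" using clean by simp
      then have "s(b + 3 := s k, b + 1 := v) = ?S 0 v" for v by (intro ext) simp
      then show ?thesis
        using computesD[OF c, of "s(b + 3 := s k)" u] clean unfolding ps_map by simp
    qed
    have body: "(?S z v, u) \<in> sem ?body \<longleftrightarrow>
        z < s k \<and> (\<exists>v'. g (z # v # ?xs) = Some v' \<and> u = ?S (Suc z) v')" for z v u
    proof -
      let ?S' = "s(b := z, b + 1 := v, b + 3 := s k - Suc z)"
      have "map ?S' (b # (b + 1) # ps) = z # v # ?xs" using ps(1) by auto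
      then have d': "(?S', u) \<in> sem d \<longleftrightarrow> (\<exists>v'. g (z # v # ?xs) = Some v' \<and> u = ?S'(b + 2 := v'))" for u
        using computesD[OF d, of ?S' u] clean by (simp del: list.map)
      have dec: "(?S z v, u) \<in> sem (Dec (b + 3)) \<longleftrightarrow> z < s k \<and> u = ?S'" for u
        unfolding sem_iff(3) by simp
      have "(?S z v, u) \<in> sem ?body \<longleftrightarrow> z < s k \<and> (\<exists>w. (?S', w) \<in> sem d \<and>
          (w, u) \<in> sem (clear (b + 1) ;; move (b + 2) (b + 1) ;; Inc b))"
        unfolding sem_iff(5)[of _ _ "Dec _"] sem_iff(5)[of _ _ d] dec by blast
      also have "\<dots> \<longleftrightarrow> z < s k \<and> (\<exists>v'. g (z # v # ?xs) = Some v' \<and>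
          (?S'(b + 2 := v'), u) \<in> sem (clear (b + 1) ;; move (b + 2) (b + 1) ;; Inc b))"
        unfolding d' by blast
      also have "\<dots> \<longleftrightarrow> z < s k \<and> (\<exists>v'. g (z # v # ?xs) = Some v' \<and> u = ?S (Suc z) v')"
      proof -
        have "s (b + 2) = 0" using clean by simp
        then have "?S'(b + 2 := v', b + 1 := v', b + 2 := 0, b := Suc z) = ?S (Suc z) v'" for v'
          by (intro ext) simp
        then have "(?S'(b + 2 := v'), u) \<in> sem (clear (b + 1) ;; move (b + 2) (b + 1) ;; Inc b) \<longleftrightarrow>
          u = ?S (Suc z) v'" for v'
          using sem_replace_inc[of b "b + 1" "b + 2" "?S'(b + 2 := v')" u] by simp
        then show ?thesis by simp
      qed
      finally show ?thesis .
    qed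
    have star: "(?S 0 v, u) \<in> sem (Star ?body) \<longleftrightarrow>
        (\<exists>z v. z \<le> s k \<and> ?pr z = Some v \<and> u = ?S z v)" if v: "f ?xs = Some v" for v u
    proof -
      \<comment> \<open>\<open>the\<close> makes the chain of stores total, as the lemma on
        functional loops demands; the guard ensures that only stores with a defined value are
        reached.\<close>
      have "(?S 0 (the (?pr 0)), u) \<in> (sem ?body)\<^sup>* \<longleftrightarrow>
        (\<exists>z. u = ?S z (the (?pr z)) \<and> (\<forall>y<z. y < s k \<and> ?pr (Suc y) \<noteq> None))"
      proof (rule rtrancl_functional_iff)
        fix z u
        assume "\<And>y. y < z \<Longrightarrow> y < s k \<and> ?pr (Suc y) \<noteq> None"
        then have "?pr z \<noteq> None" using v by (cases z) auto
        then show "(?S z (the (?pr z)), u) \<in> sem ?body \<longleftrightarrow>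
          (z < s k \<and> ?pr (Suc z) \<noteq> None) \<and> u = ?S (Suc z) (the (?pr (Suc z)))"
          unfolding body by auto
      qed
      also have "\<dots> \<longleftrightarrow> (\<exists>z v. z \<le> s k \<and> ?pr z = Some v \<and> u = ?S z v)"
      proof -
        have "(\<forall>y<z. y < s k \<and> ?pr (Suc y) \<noteq> None) \<longleftrightarrow> z \<le> s k \<and> (\<exists>v. ?pr z = Some v)" for z
          using v by (induction z) (auto simp: less_Suc_eq bind_eq_Some_conv)
        then show ?thesis by (intro ex_cong1) auto
      qed
      finally show ?thesis using v by (simp add: sem.simps(6))
    qed
    have "(s, t) \<in> sem ?prog \<longleftrightarrow> (\<exists>v. f ?xs = Some v \<and> (\<exists>u. (?S 0 v, u) \<in> sem (Star ?body) \<and>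
        (u, t) \<in> sem (ZeroTest (b + 3) ;; clear b ;; move (b + 1) out)))"
      unfolding sem_iff(5)[of _ _ "copy _ _ _"] sem_iff(5)[of _ _ c] sem_iff(5)[of _ _ "Star _"]
        copy simp_thms c' by blast
    also have "\<dots> \<longleftrightarrow> (\<exists>v z v'. f ?xs = Some v \<and> z \<le> s k \<and> ?pr z = Some v' \<and>
        (?S z v', t) \<in> sem (ZeroTest (b + 3) ;; clear b ;; move (b + 1) out))"
      using star by (auto 4 4)
    also have "\<dots> \<longleftrightarrow> (\<exists>v z v'. f ?xs = Some v \<and> z = s k \<and> ?pr z = Some v' \<and> t = s(out := v'))"
    proof -
      have "s b = 0" "s (b + 1) = 0" "s (b + 3) = 0" using clean by simp_all
      then have "(?S (s k) v')(b := 0, b + 1 := 0, out := v') = s(out := v')" for v'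
        using out(1) by (intro ext) simp
      then have "z \<le> s k \<and> (?S z v', t) \<in> sem (ZeroTest (b + 3) ;; clear b ;; move (b + 1) out) \<longleftrightarrow>
        z = s k \<and> t = s(out := v')" for z v'
        using sem_test_clear_move[of b "b + 1" out "?S z v'" t "b + 3"] out(1) s_out
        by (cases "z = s k") auto
      then show ?thesis by blast
    qed
    also have "\<dots> \<longleftrightarrow> (\<exists>v. ?pr (s k) = Some v \<and> t = s(out := v))"
    proof -
      \<comment> \<open>An undefined base value would make all later values undefined.\<close>
      have "?pr z = Some v \<Longrightarrow> \<exists>v. f ?xs = Some v" for z v
        by (induction z arbitrary: v) (auto simp: bind_eq_Some_conv)
      then show ?thesis by blast
    qed
    finally show ?thesis .
  qed
  then have "computes ?prog (\<lambda>xs. primitive_recursion f g (hd xs) (tl xs)) ins out b"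
    unfolding computes_def kps(1) by simp
  then show "\<exists>c. computes c (\<lambda>xs. primitive_recursion f g (hd xs) (tl xs)) ins out b" ..
qed

lemma partial_recursive_computable_at: "partial_recursive n f \<Longrightarrow> computable_at f n"
proof (induction rule: partial_recursive.induct)
  case (zero n)
  \<comment> \<open>\<open>Skip\<close> suffices because \<open>out\<close> is zero
    beforehand.\<close>
  have "computes Skip (\<lambda>xs. Some 0) ins out b" for ins out b
    by (auto simp: computes_def sem_iff fun_upd_idem)
  then show ?case unfolding computable_at_def by blast
qed (auto intro: computable_at_proj computable_at_comp computable_at_prec computable_at_mu
    computable_at_succ[unfolded One_nat_def])

section \<open>Queue machines\<close>

datatype sym = Blank | End | Reg nat

text \<open>In state \<open>Pre k\<close> there are still \<open>k\<close> units of the input to be appended to the queue.\<close>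

datatype st = Pre nat | St nat

type_synonym rule = "st \<times> sym \<times> st \<times> sym \<times> sym"

definition qstep :: "rule set \<Rightarrow> ((st \<times> sym list) \<times> (st \<times> sym list)) set" where
  "qstep M = {((p, x # u), (q, u @ [y, z])) | p x u q y z. (p, x, q, y, z) \<in> M}"

lemma qstepI: "(p, x, q, y, z) \<in> M \<Longrightarrow> ((p, x # u), (q, u @ [y, z])) \<in> qstep M"
  unfolding qstep_def by blast

lemma qstepE:
  assumes "((p, w), d) \<in> qstep M"
  obtains x u q y z where "w = x # u" "d = (q, u @ [y, z])" "(p, x, q, y, z) \<in> M"
  using assms unfolding qstep_def by blast

section \<open>Compilation of counter programs to queue rules\<close>

definition alphabet :: "nat \<Rightarrow> sym set" where
  "alphabet R = {Blank, End} \<union> Reg ` {..<R}"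

text \<open>The idle step: it rotates the queue by one symbol, and as two symbols must be appended,
  the second is a blank.\<close>

definition pass :: "sym set \<Rightarrow> st \<Rightarrow> st \<Rightarrow> rule set" where
  "pass A p q = (\<lambda>x. (p, x, q, x, Blank)) ` A"

primrec fresh :: "com \<Rightarrow> nat" where
  "fresh Skip = 0"
| "fresh (Inc r) = 0"
| "fresh (Dec r) = 0"
| "fresh (ZeroTest r) = 1"
| "fresh (c ;; d) = Suc (fresh c + fresh d)"
| "fresh (Star c) = Suc (fresh c)"

text \<open>\<open>p\<close> is the entry, \<open>q\<close> the exit, \<open>n\<close> the first
  free number for inner states. \<open>Dec\<close> rotates until it chooses to consume a
  \<open>Reg r\<close>. \<open>ZeroTest\<close> rotates to \<open>End\<close> and then makes one
  full revolution in \<open>St n\<close>, where no rule reads \<open>Reg r\<close>. The loop state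
  of \<open>Star\<close> is separate from entry and exit, so that it can carry its own
  assertion.\<close>

primrec rules_of :: "nat \<Rightarrow> com \<Rightarrow> st \<Rightarrow> st \<Rightarrow> nat \<Rightarrow> rule set" where
  "rules_of R Skip p q n = pass (alphabet R) p q"
| "rules_of R (Inc r) p q n = (\<lambda>x. (p, x, q, x, Reg r)) ` alphabet R"
| "rules_of R (Dec r) p q n = pass (alphabet R) p p \<union> {(p, Reg r, q, Blank, Blank)}"
| "rules_of R (ZeroTest r) p q n =
     pass (alphabet R) p p \<union> {(p, End, St n, End, Blank)} \<union>
     pass (alphabet R - {End, Reg r}) (St n) (St n) \<union> {(St n, End, q, End, Blank)}"
| "rules_of R (c ;; d) p q n =
     rules_of R c p (St n) (Suc n) \<union> rules_of R d (St n) q (Suc n + fresh c)"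
| "rules_of R (Star c) p q n =
     pass (alphabet R) p (St n) \<union> rules_of R c (St n) (St n) (Suc n) \<union> pass (alphabet R) (St n) q"

primrec regs_below :: "nat \<Rightarrow> com \<Rightarrow> bool" where
  "regs_below R Skip \<longleftrightarrow> True"
| "regs_below R (Inc r) \<longleftrightarrow> r < R"
| "regs_below R (Dec r) \<longleftrightarrow> r < R"
| "regs_below R (ZeroTest r) \<longleftrightarrow> r < R"
| "regs_below R (c ;; d) \<longleftrightarrow> regs_below R c \<and> regs_below R d"
| "regs_below R (Star c) \<longleftrightarrow> regs_below R c"

lemma regs_below_mono: "regs_below R c \<Longrightarrow> R \<le> R' \<Longrightarrow> regs_below R' c"
  by (induction c) auto

lemma ex_regs_below: "\<exists>R>0. regs_below R c"
proof (induction c)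
  case (Seq c d)
  then obtain R R' where "R > 0" "regs_below R c" "regs_below R' d" by blast
  then show ?case by (intro exI[of _ "max R R'"]) (auto intro: regs_below_mono)
qed auto

lemma finite_rules_of: "finite (rules_of R c p q n)"
  by (induction c arbitrary: p q n) (auto simp: pass_def alphabet_def)

text \<open>Keeps the parts of a compiled program apart: they meet only in entry and exit states.
  \<open>p\<close> also occurs as a target because \<open>Dec\<close> and \<open>ZeroTest\<close>
  rotate in their entry state.\<close>

lemma rules_of_states:
  assumes "(a, x, b, y, z) \<in> rules_of R c p q n"
  shows "a \<in> insert p (St ` {n..<n + fresh c})" "b \<in> {p, q} \<union> St ` {n..<n + fresh c}"
proof -
  have "a \<in> insert p (St ` {n..<n + fresh c}) \<and> b \<in> {p, q} \<union> St ` {n..<n + fresh c}"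
    using assms
  proof (induction c arbitrary: p q n)
    case (Seq c d)
    then consider "(a, x, b, y, z) \<in> rules_of R c p (St n) (Suc n)" |
      "(a, x, b, y, z) \<in> rules_of R d (St n) q (Suc n + fresh c)" by auto
    then show ?case
    proof cases
      case 1
      with Seq.IH(1) show ?thesis by fastforce
    next
      case 2
      with Seq.IH(2) show ?thesis by fastforce
    qed
  next
    case (Star c)
    then consider "(a, x, b, y, z) \<in> rules_of R c (St n) (St n) (Suc n)" |
      "(a, x, b, y, z) \<in> pass (alphabet R) p (St n) \<union> pass (alphabet R) (St n) q" by auto
    then show ?case
    proof cases
      case 1
      with Star.IH show ?thesis by fastforce
    qed (auto simp: pass_def)
  qed (auto simp: pass_def)
  then show "a \<in> insert p (St ` {n..<n + fresh c})" "b \<in> {p, q} \<union> St ` {n..<n + fresh c}"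
    by blast+
qed

lemma rules_of_symbols:
  "(a, x, b, y, z) \<in> rules_of R c p q n \<Longrightarrow> regs_below R c \<Longrightarrow> {x, y, z} \<subseteq> alphabet R"
proof (induction c arbitrary: p q n)
  case (Seq c d)
  then show ?case unfolding rules_of.simps regs_below.simps by blast
next
  case (Star c)
  then consider "(a, x, b, y, z) \<in> rules_of R c (St n) (St n) (Suc n)" |
    "(a, x, b, y, z) \<in> pass (alphabet R) p (St n) \<union> pass (alphabet R) (St n) q" by auto
  then show ?case using Star.IH Star.prems(2)
    by cases (simp, auto simp: pass_def alphabet_def)
qed (auto simp: pass_def alphabet_def)

section \<open>Soundness of the compilation, by backward assertions\<close>

definition contents :: "sym list \<Rightarrow> store" where
  "contents w = (\<lambda>r. count_list w (Reg r))"

lemma contents_rotate: "contents (u @ [x, Blank]) = contents (x # u)"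
  by (rule ext) (simp add: contents_def)

text \<open>\<open>K p w\<close> stands for a consequence of the existence of an accepting run from \<open>(p, w)\<close>, so it
  is propagated against the direction of the rules.\<close>

definition consistent :: "(st \<Rightarrow> sym list \<Rightarrow> bool) \<Rightarrow> rule set \<Rightarrow> bool" where
  "consistent K M \<longleftrightarrow> (\<forall>(p, x, q, y, z)\<in>M. \<forall>u. K q (u @ [y, z]) \<longrightarrow> K p (x # u))"

lemma consistent_union: "consistent K (M \<union> N) \<longleftrightarrow> consistent K M \<and> consistent K N"
  unfolding consistent_def by blast

lemma consistent_singleton:
  "consistent K {(p, x, q, y, z)} \<longleftrightarrow> (\<forall>u. K q (u @ [y, z]) \<longrightarrow> K p (x # u))"
  by (simp add: consistent_def)

lemma consistent_pass_iff:
  "consistent K (pass A p q) \<longleftrightarrow> (\<forall>x\<in>A. \<forall>u. K q (u @ [x, Blank]) \<longrightarrow> K p (x # u))"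
  by (simp add: consistent_def pass_def)

lemma consistent_run:
  assumes "consistent K M" "((p, w), (q, w')) \<in> (qstep M)\<^sup>*" "K q w'"
  shows "K p w"
  using assms(2,3)
proof (induction "(p, w)" arbitrary: p w rule: converse_rtrancl_induct)
  case (step d)
  from step(1) obtain x u q y z where "w = x # u" "d = (q, u @ [y, z])" "(p, x, q, y, z) \<in> M"
    by (rule qstepE)
  with step(3)[OF _ step(4)] assms(1) show ?case unfolding consistent_def by fastforce
qed

text \<open>Only words with exactly one \<open>End\<close> encode a store. The compiled rules
  preserve the number of \<open>End\<close>, so making the assertion vacuous on other words costs
  nothing.\<close>

definition lifted :: "(store \<Rightarrow> bool) \<Rightarrow> sym list \<Rightarrow> bool" where
  "lifted P w \<longleftrightarrow> (count_list w End = 1 \<longrightarrow> P (contents w))"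

lemma consistent_pass:
  assumes "K p = lifted P" "K q = lifted Q" "\<And>s. Q s \<Longrightarrow> P s"
  shows "consistent K (pass A p q)"
  unfolding consistent_pass_iff
  using assms by (auto simp: lifted_def contents_rotate split: if_splits)

text \<open>Soundness becomes a check of single rules, so no run has to be analysed. The assertions
  at entry and exit are given, those at inner states are chosen; the freshness assumptions on
  \<open>p\<close> and \<open>q\<close> keep the choice from overwriting what is given.\<close>

lemma rules_of_sound:
  assumes "p \<notin> St ` {n..}" "q \<notin> St ` {n..}" "K p = lifted P" "K q = lifted Q"
    and "\<And>s t. (s, t) \<in> sem c \<Longrightarrow> Q t \<Longrightarrow> P s"
  shows "\<exists>K'. (\<forall>a. a \<notin> St ` {n..} \<longrightarrow> K' a = K a) \<and> consistent K' (rules_of R c p q n)"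
  using assms
proof (induction c arbitrary: p q n P Q K)
  case Skip
  then have "consistent K (rules_of R Skip p q n)"
    by (auto simp: sem_iff intro: consistent_pass)
  then show ?case by blast
next
  case (Inc r)
  have "consistent K (rules_of R (Inc r) p q n)"
    unfolding consistent_def
  proof clarsimp
    fix x u assume *: "K q (u @ [x, Reg r])"
    have "contents (u @ [x, Reg r]) = (contents (x # u))(r := Suc (contents (x # u) r))"
      by (auto simp: contents_def)
    then have "(contents (x # u), contents (u @ [x, Reg r])) \<in> sem (Inc r)"
      unfolding sem_iff .
    from * Inc.prems(5)[OF this] show "K p (x # u)"
      by (auto simp: Inc.prems(3,4) lifted_def split: if_splits)
  qed
  then show ?case by blast
next
  case (Dec r)
  have "K p (Reg r # u)" if "K q (u @ [Blank, Blank])" for u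
  proof -
    have "contents (u @ [Blank, Blank]) = (contents (Reg r # u))(r := contents (Reg r # u) r - 1)"
      "contents (Reg r # u) r > 0"
      by (auto simp: contents_def)
    then have "(contents (Reg r # u), contents (u @ [Blank, Blank])) \<in> sem (Dec r)"
      unfolding sem_iff by blast
    from that Dec.prems(5)[OF this] show ?thesis
      by (auto simp: Dec.prems(3,4) lifted_def)
  qed
  moreover have "consistent K (pass (alphabet R) p p)"
    by (rule consistent_pass[where P = P and Q = P]) (use Dec.prems(3) in simp_all)
  ultimately have "consistent K (rules_of R (Dec r) p q n)"
    unfolding rules_of.simps consistent_union consistent_singleton by blast
  then show ?case by blast
next
  case (ZeroTest r)
  \<comment> \<open>In state \<open>St n\<close> the part of the queue behind \<open>End\<close> has been scanned and is free of \<open>Reg r\<close>.\<close>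
  define Z where "Z w \<longleftrightarrow> (\<forall>u v. w = u @ End # v \<and> End \<notin> set u \<union> set v \<and> Reg r \<notin> set v \<longrightarrow>
    Reg r \<notin> set u \<and> Q (contents w))" for w
  let ?K = "K(St n := Z)"
  have pq: "?K p = lifted P" "?K q = lifted Q" "?K (St n) = Z" "p \<noteq> St n" "q \<noteq> St n"
    using ZeroTest.prems by auto
  have "consistent ?K (pass (alphabet R) p p)"
    by (rule consistent_pass[where P = P and Q = P]) (simp_all only: pq(1))
  moreover have "?K p (End # u)" if scanned: "?K (St n) (u @ [End, Blank])" for u
  proof -
    have "P (contents (End # u))" if one: "count_list (End # u) End = 1"
    proof -
      from one have "End \<notin> set u" by (simp add: count_list_0_iff)
      \<comment> \<open>When \<open>End\<close> is first read it moves to the back with one blank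
        behind it: the scanned part is \<open>[Blank]\<close>, and all of \<open>u\<close> is still
        to be scanned.\<close>
      with scanned[unfolded pq Z_def, rule_format, of u "[Blank]"]
      have "Reg r \<notin> set u" "Q (contents (u @ [End, Blank]))" by auto
      then show ?thesis
        using ZeroTest.prems(5)[of "contents (End # u)" "contents (End # u)"]
        by (simp add: sem_iff contents_rotate) (simp add: contents_def count_list_0_iff)
    qed
    then show ?thesis by (simp only: pq lifted_def) simp
  qed
  moreover have "?K (St n) (x # u)"
    if "x \<in> alphabet R - {End, Reg r}" "?K (St n) (u @ [x, Blank])" for x u
  proof -
    have "Reg r \<notin> set u' \<and> Q (contents (x # u))"
      if u': "x # u = u' @ End # v" "End \<notin> set u' \<union> set v" "Reg r \<notin> set v" for u' v
    proof -
      from u' \<open>x \<in> _\<close> obtain u'' where u'': "u' = x # u''" "u = u'' @ End # v"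
        by (cases u') auto
      \<comment> \<open>The symbol read moves from the unscanned part before \<open>End\<close> to
        the scanned part behind it.\<close>
      then have "u @ [x, Blank] = u'' @ End # (v @ [x, Blank])" by simp
      moreover have "End \<notin> set u'' \<union> set (v @ [x, Blank])" "Reg r \<notin> set (v @ [x, Blank])"
        using u' u'' \<open>x \<in> _\<close> by auto
      ultimately have "Reg r \<notin> set u'' \<and> Q (contents (u @ [x, Blank]))"
        using \<open>?K (St n) (u @ [x, Blank])\<close> unfolding pq Z_def by blast
      then show ?thesis
        unfolding contents_rotate using u''(1) \<open>x \<in> _\<close> by auto
    qed
    then show ?thesis unfolding pq Z_def by blast
  qed
  moreover have "?K (St n) (End # u)" if "?K q (u @ [End, Blank])" for u
  proof -
    have "Q (contents (End # u))" if "End \<notin> set u"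
    proof -
      have "count_list u End = 0" using that by (simp add: count_list_0_iff)
      with \<open>?K q (u @ [End, Blank])\<close> show ?thesis
        unfolding pq lifted_def by (simp add: contents_rotate)
    qed
    then show ?thesis unfolding pq Z_def by (auto simp: Cons_eq_append_conv)
  qed
  ultimately have "consistent ?K (rules_of R (ZeroTest r) p q n)"
    unfolding rules_of.simps consistent_union consistent_singleton consistent_pass_iff by blast
  moreover have "\<forall>a. a \<notin> St ` {n..} \<longrightarrow> ?K a = K a" by auto
  ultimately show ?case by blast
next
  case (Seq c d)
  \<comment> \<open>The weakest precondition for some run of \<open>d\<close> to reach
    \<open>Q\<close>, placed at the state between the two programs.\<close>
  define P' where "P' s \<longleftrightarrow> (\<exists>t. (s, t) \<in> sem d \<and> Q t)" for s
  let ?K = "K(St n := lifted P')"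
  let ?m = "Suc n + fresh c"
  have pq: "?K p = lifted P" "?K q = lifted Q" "?K (St n) = lifted P'"
    "p \<notin> St ` {Suc n..}" "q \<notin> St ` {?m..}" "St n \<notin> St ` {Suc n..}" "St n \<notin> St ` {?m..}"
    "p \<notin> St ` {?m..}"
    using Seq.prems by auto
  have step: "P s" if "(s, t) \<in> sem c" "P' t" for s t
  proof -
    from that obtain t' where "(s, t') \<in> sem (c ;; d)" "Q t'"
      unfolding P'_def sem_iff by blast
    then show ?thesis by (rule Seq.prems(5))
  qed
  have "\<exists>K'. (\<forall>a. a \<notin> St ` {Suc n..} \<longrightarrow> K' a = ?K a) \<and>
      consistent K' (rules_of R c p (St n) (Suc n))"
    by (rule Seq.IH(1)[where P = P and Q = P', OF pq(4,6,1,3)]) (rule step)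
  then obtain K1 where
    K1: "\<And>a. a \<notin> St ` {Suc n..} \<Longrightarrow> K1 a = ?K a" "consistent K1 (rules_of R c p (St n) (Suc n))"
    by blast
  have "q \<notin> St ` {Suc n..}" using Seq.prems by auto
  then have K1': "K1 (St n) = lifted P'" "K1 q = lifted Q"
    using K1(1)[OF pq(6)] K1(1)[of q] pq(2,3) by simp_all
  have "\<exists>K'. (\<forall>a. a \<notin> St ` {?m..} \<longrightarrow> K' a = K1 a) \<and>
      consistent K' (rules_of R d (St n) q ?m)"
    by (rule Seq.IH(2)[where P = P' and Q = Q, OF pq(7,5) K1']) (auto simp: P'_def)
  then obtain K2 where
    K2: "\<And>a. a \<notin> St ` {?m..} \<Longrightarrow> K2 a = K1 a" "consistent K2 (rules_of R d (St n) q ?m)"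
    by blast
  have "\<forall>a. a \<notin> St ` {n..} \<longrightarrow> K2 a = K a"
  proof (intro allI impI)
    fix a assume "a \<notin> St ` {n..}"
    then have "a \<notin> St ` {?m..}" "a \<notin> St ` {Suc n..}" "a \<noteq> St n" by auto
    then show "K2 a = K a" using K1(1) K2(1) by simp
  qed
  \<comment> \<open>The assertions chosen for \<open>d\<close> concern states from \<open>?m\<close>
    on, which no rule of \<open>c\<close> mentions.\<close>
  moreover have "consistent K2 (rules_of R c p (St n) (Suc n))"
    unfolding consistent_def
  proof clarify
    fix a x b y z u
    assume rule: "(a, x, b, y, z) \<in> rules_of R c p (St n) (Suc n)" and K: "K2 b (u @ [y, z])"
    have "a \<notin> St ` {?m..} \<and> b \<notin> St ` {?m..}"
      using rules_of_states[OF rule] pq(8) by auto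
    then show "K2 a (x # u)" using rule K K1(2) unfolding consistent_def by (auto simp: K2(1))
  qed
  ultimately show ?case using K2(2) by (auto simp: consistent_union)
next
  case (Star c)
  \<comment> \<open>The loop invariant, read backwards: some number of further rounds leads to
    \<open>Q\<close>.\<close>
  define P' where "P' s \<longleftrightarrow> (\<exists>t. (s, t) \<in> (sem c)\<^sup>* \<and> Q t)" for s
  let ?K = "K(St n := lifted P')"
  have pq: "?K p = lifted P" "?K q = lifted Q" "?K (St n) = lifted P'"
    "St n \<notin> St ` {Suc n..}" "p \<notin> St ` {Suc n..}" "q \<notin> St ` {Suc n..}"
    using Star.prems by auto
  have step: "P' s" if "(s, t) \<in> sem c" "P' t" for s t
    using that by (auto simp: P'_def intro: converse_rtrancl_into_rtrancl)
  have "\<exists>K'. (\<forall>a. a \<notin> St ` {Suc n..} \<longrightarrow> K' a = ?K a) \<and>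
      consistent K' (rules_of R c (St n) (St n) (Suc n))"
    by (rule Star.IH[where K = ?K and p = "St n" and q = "St n" and P = P' and Q = P', OF pq(4,4,3,3)]) (rule step)
  then obtain K1 where
    K1: "\<And>a. a \<notin> St ` {Suc n..} \<Longrightarrow> K1 a = ?K a"
      "consistent K1 (rules_of R c (St n) (St n) (Suc n))"
    by blast
  have K1': "K1 p = lifted P" "K1 q = lifted Q" "K1 (St n) = lifted P'"
    using K1(1)[OF pq(4)] K1(1)[OF pq(5)] K1(1)[OF pq(6)] pq(1-3) by simp_all
  have "consistent K1 (pass (alphabet R) p (St n))"
    using K1'(1,3) by (rule consistent_pass[where P = P and Q = P']) (use Star.prems(5) in \<open>auto simp: P'_def sem.simps(6)\<close>)
  moreover have "consistent K1 (pass (alphabet R) (St n) q)"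
    using K1'(3,2) by (rule consistent_pass[where P = P' and Q = Q]) (auto simp: P'_def)
  moreover have "\<forall>a. a \<notin> St ` {n..} \<longrightarrow> K1 a = K a"
  proof (intro allI impI)
    fix a assume "a \<notin> St ` {n..}"
    then have "a \<notin> St ` {Suc n..}" "a \<noteq> St n" by auto
    then show "K1 a = K a" using K1(1) by simp
  qed
  ultimately show ?case using K1(2) by (auto simp: consistent_union)
qed

section \<open>Completeness of the compilation, by explicit runs\<close>

definition pad :: "sym list \<Rightarrow> sym list" where
  "pad u = concat (map (\<lambda>x. [x, Blank]) u)"

lemma pad_simps [simp]: "pad [] = []" "pad (x # u) = x # Blank # pad u"
  by (simp_all add: pad_def)

lemma set_pad: "set (pad u) \<subseteq> insert Blank (set u)"
  by (induction u) auto

lemma count_list_pad: "x \<noteq> Blank \<Longrightarrow> count_list (pad u) x = count_list u x"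
  by (induction u) auto

lemma rotate_run:
  assumes "pass A p p \<subseteq> M" "set u \<subseteq> A"
  shows "((p, u @ v), (p, v @ pad u)) \<in> (qstep M)\<^sup>*"
  using assms(2)
proof (induction u arbitrary: v)
  case (Cons x u)
  then have "((p, x # u @ v), (p, (u @ v) @ [x, Blank])) \<in> qstep M"
    using assms(1) by (intro qstepI) (auto simp: pass_def)
  with Cons(1)[of "v @ [x, Blank]"] Cons(2) show ?case
    by (auto intro: converse_rtrancl_into_rtrancl)
qed simp

definition represents :: "nat \<Rightarrow> sym list \<Rightarrow> store \<Rightarrow> bool" where
  "represents R w s \<longleftrightarrow> set w \<subseteq> alphabet R \<and> count_list w End = 1 \<and> contents w = s"

lemma pass_step:
  assumes "represents R w s" "pass (alphabet R) p q \<subseteq> M"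
  shows "\<exists>w'. ((p, w), (q, w')) \<in> qstep M \<and> represents R w' s"
proof -
  from assms(1) obtain x u where w: "w = x # u" by (cases w) (auto simp: represents_def)
  with assms have "(p, x, q, x, Blank) \<in> M" by (auto simp: pass_def represents_def)
  from qstepI[OF this, of u] show ?thesis
    using assms(1) w by (intro exI[of _ "u @ [x, Blank]"])
      (auto simp: represents_def contents_def alphabet_def)
qed

lemma rules_of_complete:
  assumes "(s, t) \<in> sem c" "represents R w s" "rules_of R c p q n \<subseteq> M" "regs_below R c"
  shows "\<exists>w'. ((p, w), (q, w')) \<in> (qstep M)\<^sup>* \<and> represents R w' t"
  using assms
proof (induction c arbitrary: s t w p q n)
  case Skip
  then show ?case using pass_step[of R w s p q M] by (auto simp: sem_iff)
next
  case (Inc r)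
  then obtain x u where w: "w = x # u" by (cases w) (auto simp: represents_def)
  with Inc.prems have "(p, x, q, x, Reg r) \<in> M" by (auto simp: represents_def)
  from qstepI[OF this, of u] have "((p, w), (q, u @ [x, Reg r])) \<in> (qstep M)\<^sup>*"
    using w by auto
  moreover have "represents R (u @ [x, Reg r]) t"
    using Inc.prems w by (auto simp: represents_def contents_def sem_iff alphabet_def)
  ultimately show ?case by blast
next
  case (Dec r)
  then have "Reg r \<in> set w"
    using count_list_0_iff[of w "Reg r"] by (auto simp: represents_def contents_def sem_iff)
  then obtain u v where w: "w = u @ Reg r # v" by (auto dest: split_list)
  let ?w = "v @ pad u @ [Blank, Blank]"
  have "((p, w), (p, Reg r # v @ pad u)) \<in> (qstep M)\<^sup>*"
    using Dec.prems w rotate_run[of "alphabet R" p M u "Reg r # v"] by (auto simp: represents_def)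
  also have "((p, Reg r # v @ pad u), (q, (v @ pad u) @ [Blank, Blank])) \<in> qstep M"
    using Dec.prems by (intro qstepI) auto
  finally have "((p, w), (q, ?w)) \<in> (qstep M)\<^sup>*" by simp
  moreover have "represents R ?w t"
    using Dec.prems w set_pad[of u]
    by (auto simp: represents_def contents_def sem_iff count_list_pad alphabet_def)
  ultimately show ?case by blast
next
  case (ZeroTest r)
  then have "End \<in> set w" using count_list_0_iff[of w End] by (auto simp: represents_def)
  then obtain u v where w: "w = u @ End # v" by (auto dest: split_list)
  let ?v = "v @ pad u"
  \<comment> \<open>The first blank was appended with \<open>End\<close> when the revolution began,
    the last one when it ended.\<close>
  let ?w = "Blank # pad ?v @ [End, Blank]"
  from ZeroTest.prems w have free: "End \<notin> set (u @ v)" "Reg r \<notin> set (u @ v)"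
    by (auto simp: represents_def contents_def sem_iff count_list_0_iff)
  then have "set ?v \<subseteq> alphabet R - {End, Reg r}"
    using ZeroTest.prems w set_pad[of u] by (auto simp: represents_def alphabet_def)
  note scan = rotate_run[OF _ this, of "St n" M "[End, Blank]"]
  have "((p, w), (p, End # ?v)) \<in> (qstep M)\<^sup>*"
    using ZeroTest.prems w rotate_run[of "alphabet R" p M u "End # v"] by (auto simp: represents_def)
  also have "((p, End # ?v), (St n, ?v @ [End, Blank])) \<in> qstep M"
    using ZeroTest.prems by (intro qstepI) auto
  also have "((St n, ?v @ [End, Blank]), (St n, End # Blank # pad ?v)) \<in> (qstep M)\<^sup>*"
    using scan ZeroTest.prems by auto
  also have "((St n, End # Blank # pad ?v), (q, (Blank # pad ?v) @ [End, Blank])) \<in> qstep M"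
    using ZeroTest.prems by (intro qstepI) auto
  finally have "((p, w), (q, ?w)) \<in> (qstep M)\<^sup>*" by simp
  moreover have "represents R ?w t"
    using ZeroTest.prems w set_pad[of u] set_pad[of ?v]
    by (auto simp: represents_def contents_def sem_iff count_list_pad alphabet_def)
  ultimately show ?case by blast
next
  case (Seq c d)
  from Seq.prems(1) obtain s' where s': "(s, s') \<in> sem c" "(s', t) \<in> sem d" by (auto simp: sem_iff)
  from Seq.IH(1)[OF s'(1) Seq.prems(2), of p "St n" "Suc n"] Seq.prems
  obtain w1 where w1: "((p, w), (St n, w1)) \<in> (qstep M)\<^sup>*" "represents R w1 s'" by auto
  from Seq.IH(2)[OF s'(2) w1(2), of "St n" q "Suc n + fresh c"] Seq.prems
  obtain w2 where "((St n, w1), (q, w2)) \<in> (qstep M)\<^sup>*" "represents R w2 t" by auto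
  with w1 show ?case by (meson rtrancl_trans)
next
  case (Star c)
  then have sub: "pass (alphabet R) p (St n) \<subseteq> M" "pass (alphabet R) (St n) q \<subseteq> M"
    "rules_of R c (St n) (St n) (Suc n) \<subseteq> M" by auto
  from pass_step[OF Star.prems(2) sub(1)] obtain w1 where
    w1: "((p, w), (St n, w1)) \<in> qstep M" "represents R w1 s" by blast
  have "(s, t) \<in> (sem c)\<^sup>*" using Star.prems(1) by (simp add: sem.simps(6))
  then have "\<exists>w2. ((St n, w1), (St n, w2)) \<in> (qstep M)\<^sup>* \<and> represents R w2 t"
  proof (induction rule: rtrancl_induct)
    case base
    then show ?case using w1(2) by blast
  next
    case (step s' t')
    then obtain w2 where w2: "((St n, w1), (St n, w2)) \<in> (qstep M)\<^sup>*" "represents R w2 s'" by blast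
    from Star.IH[OF step(2) w2(2) sub(3)] Star.prems(4) obtain w3 where
      "((St n, w2), (St n, w3)) \<in> (qstep M)\<^sup>*" "represents R w3 t'" by auto
    with w2 show ?case by (meson rtrancl_trans)
  qed
  then obtain w2 where w2: "((St n, w1), (St n, w2)) \<in> (qstep M)\<^sup>*" "represents R w2 t" by blast
  from pass_step[OF w2(2) sub(2)] obtain w3 where
    "((St n, w2), (q, w3)) \<in> qstep M" "represents R w3 t" by blast
  with w1 w2 show ?case by (meson converse_rtrancl_into_rtrancl rtrancl_into_rtrancl)
qed

section \<open>Loading the input, and correctness of the whole machine\<close>

definition prelude :: "nat \<Rightarrow> rule set" where
  "prelude x = {(Pre (Suc k), y, Pre k, y, Reg 0) | k y. k < x \<and> y \<in> {End, Reg 0}}"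

text \<open>The second symbol appended here is \<open>Reg 0\<close> and never a blank, so starting
  from \<open>[End]\<close> only \<open>End\<close> and \<open>Reg 0\<close> are met; this is why
  the prelude needs rules for no other symbol.\<close>

lemma prelude_run:
  assumes "prelude x \<subseteq> M" "k \<le> x" "set w \<subseteq> {End, Reg 0}" "w \<noteq> []"
  shows "\<exists>w'. ((Pre k, w), (Pre 0, w')) \<in> (qstep M)\<^sup>* \<and> set w' \<subseteq> {End, Reg 0} \<and>
    count_list w' End = count_list w End \<and> count_list w' (Reg 0) = count_list w (Reg 0) + k"
  using assms(2-)
proof (induction k arbitrary: w)
  case (Suc k)
  then obtain y u where w: "w = y # u" by (cases w) auto
  with Suc.prems have "(Pre (Suc k), y, Pre k, y, Reg 0) \<in> M"
    using assms(1) by (auto simp: prelude_def)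
  from qstepI[OF this, of u] have step: "((Pre (Suc k), w), (Pre k, u @ [y, Reg 0])) \<in> qstep M"
    using w by simp
  from Suc.IH[of "u @ [y, Reg 0]"] Suc.prems w obtain w' where
    w': "((Pre k, u @ [y, Reg 0]), (Pre 0, w')) \<in> (qstep M)\<^sup>*" "set w' \<subseteq> {End, Reg 0}"
    "count_list w' End = count_list (u @ [y, Reg 0]) End"
    "count_list w' (Reg 0) = count_list (u @ [y, Reg 0]) (Reg 0) + k" by auto
  show ?case
    using converse_rtrancl_into_rtrancl[OF step w'(1)] w'(2-) w by (intro exI[of _ w']) auto
qed auto

text \<open>\<open>St 0\<close> is reserved for halting and \<open>St 1\<close> for the start of the
  program; inner states are numbered from \<open>2\<close>.\<close>

definition program_rules :: "nat \<Rightarrow> com \<Rightarrow> rule set" where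
  "program_rules R c = pass (alphabet R) (Pre 0) (St 1) \<union> rules_of R c (St 1) (St 0) 2"

definition accepts :: "rule set \<Rightarrow> nat \<Rightarrow> bool" where
  "accepts M x \<longleftrightarrow> (\<exists>w. ((Pre x, [End]), (St 0, w)) \<in> (qstep (M \<union> prelude x))\<^sup>*)"

lemma accepts_program_rules_iff:
  assumes "regs_below R c" "R > 0"
  shows "accepts (program_rules R c) x \<longleftrightarrow> (\<exists>t. ((\<lambda>_. 0)(0 := x), t) \<in> sem c)"
proof
  assume "\<exists>t. ((\<lambda>_. 0)(0 := x), t) \<in> sem c"
  then obtain t where t: "((\<lambda>_. 0)(0 := x), t) \<in> sem c" ..
  let ?M = "program_rules R c \<union> prelude x"
  from prelude_run[of x ?M x "[End]", OF _ order.refl] obtain w where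
    w: "((Pre x, [End]), (Pre 0, w)) \<in> (qstep ?M)\<^sup>*" "set w \<subseteq> {End, Reg 0}"
    "count_list w End = 1" "count_list w (Reg 0) = x" by auto
  have "count_list w (Reg r) = 0" if "r \<noteq> 0" for r
    using w(2) that by (auto simp: count_list_0_iff)
  then have "contents w = (\<lambda>_. 0)(0 := x)"
    using w(4) by (intro ext) (simp add: contents_def)
  moreover have "set w \<subseteq> alphabet R" using w(2) assms(2) by (auto simp: alphabet_def)
  ultimately have rep: "represents R w ((\<lambda>_. 0)(0 := x))"
    using w(3) by (simp add: represents_def)
  have sub: "pass (alphabet R) (Pre 0) (St 1) \<subseteq> ?M" "rules_of R c (St 1) (St 0) 2 \<subseteq> ?M"
    by (auto simp: program_rules_def)
  from pass_step[OF rep sub(1)] obtain w' where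
    w': "((Pre 0, w), (St 1, w')) \<in> qstep ?M" "represents R w' ((\<lambda>_. 0)(0 := x))" by blast
  from rules_of_complete[OF t w'(2) sub(2) assms(1)] obtain w'' where
    "((St 1, w'), (St 0, w'')) \<in> (qstep ?M)\<^sup>*" by blast
  with w(1) w'(1) show "accepts (program_rules R c) x"
    unfolding accepts_def by (meson rtrancl_into_rtrancl rtrancl_trans)
next
  assume "accepts (program_rules R c) x"
  then obtain w where run: "((Pre x, [End]), (St 0, w)) \<in> (qstep (program_rules R c \<union> prelude x))\<^sup>*"
    unfolding accepts_def ..
  define P where "P s \<longleftrightarrow> (\<exists>t. (s, t) \<in> sem c)" for s
  \<comment> \<open>A word in state \<open>Pre k\<close> stands for the store in which the
    \<open>k\<close> pending units have already been added to register \<open>0\<close>.\<close>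
  define K0 where "K0 a = (case a of
      Pre k \<Rightarrow> lifted (\<lambda>s. P (s(0 := s 0 + k)))
    | St m \<Rightarrow> if m = 0 then lifted (\<lambda>_. True) else lifted P)" for a
  have "\<exists>K'. (\<forall>a. a \<notin> St ` {2..} \<longrightarrow> K' a = K0 a) \<and> consistent K' (rules_of R c (St 1) (St 0) 2)"
    by (rule rules_of_sound[where P = P and Q = "\<lambda>_. True"]) (auto simp: K0_def P_def)
  then obtain K where
    K: "\<And>a. a \<notin> St ` {2..} \<Longrightarrow> K a = K0 a" "consistent K (rules_of R c (St 1) (St 0) 2)"
    by blast
  have "K (Pre k) = K0 (Pre k)" "K (St 1) = K0 (St 1)" "K (St 0) = K0 (St 0)" for k
    by (rule K(1); force)+
  then have K': "K (Pre k) = lifted (\<lambda>s. P (s(0 := s 0 + k)))" "K (St 1) = lifted P"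
    "K (St 0) = lifted (\<lambda>_. True)" for k
    by (simp_all add: K0_def)
  have "consistent K (pass (alphabet R) (Pre 0) (St 1))"
    by (rule consistent_pass[where P = P and Q = P]) (simp_all add: K' K'(2)[unfolded One_nat_def] fun_upd_idem)
  moreover have "K (Pre (Suc k)) (y # u)" if "K (Pre k) (u @ [y, Reg 0])" for k y u
  proof -
    let ?w = "u @ [y, Reg 0]"
    have "(contents (y # u))(0 := contents (y # u) 0 + Suc k) =
        (contents ?w)(0 := contents ?w 0 + k)"
      by (rule ext) (simp add: contents_def)
    moreover have "count_list (y # u) End = count_list ?w End" by simp
    ultimately show ?thesis using that by (simp only: K' lifted_def)
  qed
  then have "consistent K (prelude x)"
    by (auto simp: consistent_def prelude_def)
  ultimately have "consistent K (program_rules R c \<union> prelude x)"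
    using K(2) by (simp add: consistent_union program_rules_def)
  from consistent_run[OF this run] have "K (Pre x) [End]"
    by (simp add: K' lifted_def)
  moreover have "(contents [End])(0 := contents [End] 0 + x) = (\<lambda>_. 0)(0 := x)"
    by (auto simp: contents_def)
  ultimately show "\<exists>t. ((\<lambda>_. 0)(0 := x), t) \<in> sem c"
    by (simp add: K' lifted_def P_def)
qed

section \<open>Runs of queue machines as models of schemata\<close>

text \<open>The tags keep state atoms, symbol atoms and \<open>origin\<close> disjoint. Index
  \<open>i\<close> carries both the state before step \<open>i\<close> and the symbol read in
  it.\<close>

fun pst :: "st \<Rightarrow> nat" where
  "pst (Pre k) = prod_encode (0, k)"
| "pst (St k) = prod_encode (1, k)"

fun psym :: "sym \<Rightarrow> nat" where
  "psym (Reg r) = prod_encode (2, r)"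
| "psym Blank = prod_encode (3, 0)"
| "psym End = prod_encode (3, 1)"

definition origin :: nat where
  "origin = prod_encode (3, 2)"

lemma pst_inject [simp]: "pst a = pst b \<longleftrightarrow> a = b"
  by (cases a; cases b) auto

lemma psym_inject [simp]: "psym x = psym y \<longleftrightarrow> x = y"
  by (cases x; cases y) auto

lemma pst_neq_psym [simp]: "pst a \<noteq> psym x" "psym x \<noteq> pst a"
  by (cases a; cases x; simp)+

lemma pst_neq_origin [simp]: "pst a \<noteq> origin" "origin \<noteq> pst a"
  by (cases a; simp add: origin_def)+

lemma psym_neq_origin [simp]: "psym x \<noteq> origin" "origin \<noteq> psym x"
  by (cases x; simp add: origin_def)+

declare pst.simps [simp del] psym.simps [simp del]

abbreviation halt :: nat where
  "halt \<equiv> pst (St 0)"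

section \<open>Formulas for single steps\<close>

definition here :: "nat \<Rightarrow> nat \<Rightarrow> schema" where
  "here i p = IProp p (AVar i)"

definition nxt :: "nat \<Rightarrow> nat \<Rightarrow> schema" where
  "nxt i p = IProp p (Plus (AVar i) (Succ Zero))"

definition prv :: "nat \<Rightarrow> nat \<Rightarrow> schema" where
  "prv i p = IProp p (Minus (AVar i) (Succ Zero))"

definition dbl :: "nat \<Rightarrow> nat \<Rightarrow> schema" where
  "dbl i p = IProp p (Plus (AVar i) (AVar i))"

definition dbl1 :: "nat \<Rightarrow> nat \<Rightarrow> schema" where
  "dbl1 i p = IProp p (Plus (Plus (AVar i) (AVar i)) (Succ Zero))"

lemma holds_IProp [simp]:
  "holds \<rho> I (here i p) \<longleftrightarrow> I p (\<rho> i)"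
  "holds \<rho> I (nxt i p) \<longleftrightarrow> I p (\<rho> i + 1)"
  "holds \<rho> I (prv i p) \<longleftrightarrow> I p (\<rho> i - 1)"
  "holds \<rho> I (dbl i p) \<longleftrightarrow> I p (2 * \<rho> i)"
  "holds \<rho> I (dbl1 i p) \<longleftrightarrow> I p (2 * \<rho> i + 1)"
  by (simp_all add: here_def nxt_def prv_def dbl_def dbl1_def flip: mult_2)

lemma aeq_refl [simp]: "a \<approx> a"
  by (simp add: aeq_def)

lemma Ch_body_IProp [simp]:
  "Ch_body i (here i p)" "Ch_body i (nxt i p)" "Ch_body i (prv i p)" "Ch_body i (dbl i p)" "Ch_body i (dbl1 i p)"
  by (simp_all add: here_def nxt_def prv_def dbl_def dbl1_def body_index_def Let_def)

abbreviation imp :: "schema \<Rightarrow> schema \<Rightarrow> schema" where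
  "imp \<phi> \<psi> \<equiv> Or (Neg \<phi>) \<psi>"

definition conj :: "schema list \<Rightarrow> schema" where
  "conj \<phi>s = foldr And \<phi>s Top"

definition disj :: "schema list \<Rightarrow> schema" where
  "disj \<phi>s = foldr Or \<phi>s Bot"

lemma conj_simps [simp]:
  "holds \<rho> I (conj \<phi>s) \<longleftrightarrow> (\<forall>\<phi>\<in>set \<phi>s. holds \<rho> I \<phi>)"
  "Ch_body i (conj \<phi>s) \<longleftrightarrow> (\<forall>\<phi>\<in>set \<phi>s. Ch_body i \<phi>)"
  by (induction \<phi>s) (auto simp: conj_def)

lemma disj_simps [simp]:
  "holds \<rho> I (disj \<phi>s) \<longleftrightarrow> (\<exists>\<phi>\<in>set \<phi>s. holds \<rho> I \<phi>)"
  "Ch_body i (disj \<phi>s) \<longleftrightarrow> (\<forall>\<phi>\<in>set \<phi>s. Ch_body i \<phi>)"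
  by (induction \<phi>s) (auto simp: disj_def)

text \<open>Nondeterminism becomes a disjunction, resolved by the model. Without an applicable rule
  it is \<open>Bot\<close>, so a stuck configuration violates its step clause.\<close>

definition successors :: "rule list \<Rightarrow> st \<Rightarrow> sym \<Rightarrow> schema" where
  "successors rs a x = disj (map (\<lambda>(a, x, q, y, z). conj [nxt 1 (pst q), dbl 1 (psym y), dbl1 1 (psym z)])
     (filter (\<lambda>(a', x', _). a' = a \<and> x' = x) rs))"

lemma holds_successors:
  "holds \<rho> I (successors rs a x) \<longleftrightarrow> (\<exists>q y z. (a, x, q, y, z) \<in> set rs \<and>
     I (pst q) (\<rho> 1 + 1) \<and> I (psym y) (2 * \<rho> 1) \<and> I (psym z) (2 * \<rho> 1 + 1))"
  (is "?L \<longleftrightarrow> ?R")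
proof
  show "?L \<Longrightarrow> ?R"
    by (auto simp: successors_def)
next
  assume ?R
  then obtain q y z where rule: "(a, x, q, y, z) \<in> set rs"
    and holds: "holds \<rho> I (conj [nxt 1 (pst q), dbl 1 (psym y), dbl1 1 (psym z)])"
    by auto
  have "conj [nxt 1 (pst q), dbl 1 (psym y), dbl1 1 (psym z)] \<in>
      (\<lambda>(a, x, q, y, z). conj [nxt 1 (pst q), dbl 1 (psym y), dbl1 1 (psym z)]) `
      set (filter (\<lambda>(a', x', _). a' = a \<and> x' = x) rs)"
    using rule by (intro image_eqI[of _ _ "(a, x, q, y, z)"]) simp_all
  with holds show ?L unfolding successors_def disj_simps set_map by blast
qed

lemma Ch_body_successors: "Ch_body 1 (successors rs a x)"
  by (auto simp: successors_def)

text \<open>The conjunct \<open>Neg (here 1 halt)\<close> stops a model from making the halting atom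
  true next to another state; state atoms are not otherwise required to exclude each other.\<close>

definition program_body :: "rule list \<Rightarrow> st list \<Rightarrow> sym list \<Rightarrow> schema" where
  "program_body rs Q A = conj (map (\<lambda>(a, x).
     imp (And (here 1 (pst a)) (here 1 (psym x))) (And (Neg (here 1 halt)) (successors rs a x)))
     (List.product Q A))"

text \<open>Variable \<open>0\<close> is the parameter; the two iterations get the bound variables
  \<open>1\<close> and \<open>2\<close>, since they must not share one.\<close>

definition iteration :: "nat \<Rightarrow> schema \<Rightarrow> schema" where
  "iteration i \<phi> = BigAnd i (Succ Zero) (AVar 0) \<phi>"

text \<open>Outside iterations only the indices \<open>0\<close> and \<open>n\<close> are available,
  so the configuration at index \<open>1\<close> cannot be stated directly: \<open>origin\<close> at
  \<open>0\<close> triggers it through an atom with index \<open>i - 1\<close>. Negating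
  \<open>halt\<close> at \<open>0\<close> excludes \<open>n = 0\<close>, where all iterations are
  vacuous.\<close>

definition program_schema :: "rule list \<Rightarrow> st list \<Rightarrow> sym list \<Rightarrow> schema" where
  "program_schema rs Q A = And (iteration 1 (program_body rs Q A))
     (And (IProp origin Zero) (And (Neg (IProp halt Zero)) (IProp halt (AVar 0))))"

text \<open>Split off because it does not depend on \<open>k\<close>: in the proof of recursiveness
  its code is a constant.\<close>

definition copy_clauses :: schema where
  "copy_clauses = And (Neg (here 2 halt)) (And (dbl1 2 (psym (Reg 0)))
     (And (imp (here 2 (psym End)) (dbl 2 (psym End)))
       (imp (here 2 (psym (Reg 0))) (dbl 2 (psym (Reg 0))))))"

definition prelude_clause :: "nat \<Rightarrow> schema" where
  "prelude_clause k = imp (here 2 (pst (Pre (Suc k)))) (And (nxt 2 (pst (Pre k))) copy_clauses)"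

text \<open>The clauses are accumulated by recursion on the input, so that their code is obtained by
  primitive recursion.\<close>

primrec prelude_body :: "nat \<Rightarrow> schema" where
  "prelude_body 0 = Top"
| "prelude_body (Suc k) = And (prelude_body k) (prelude_clause k)"

definition input_schema :: "nat \<Rightarrow> schema" where
  "input_schema x = iteration 2
     (And (imp (prv 2 origin) (And (here 2 (psym End)) (here 2 (pst (Pre x))))) (prelude_body x))"

lemma holds_prelude_body:
  "holds \<rho> I (prelude_body x) \<longleftrightarrow> (\<forall>k<x. holds \<rho> I (prelude_clause k))"
  by (induction x) (auto simp: less_Suc_eq)

lemma Ch_body_prelude_body: "Ch_body 2 (prelude_body x)"
  by (induction x) (simp_all add: prelude_clause_def copy_clauses_def)

section \<open>Membership in the class\<close>

lemma avars_body_index: "body_index i a \<Longrightarrow> avars a \<subseteq> {i}"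
  by (auto simp: body_index_def avars_def aeq_def Let_def split: if_splits)

lemma Ch_bodyD:
  assumes "Ch_body i \<phi>"
  shows "less_free \<phi>" "iteration_bodies_less_free \<phi>" "bound_vars \<phi> = []" "parameters \<phi> \<subseteq> {i}"
proof -
  have "less_free \<phi> \<and> iteration_bodies_less_free \<phi> \<and> bound_vars \<phi> = [] \<and> parameters \<phi> \<subseteq> {i}"
    using assms by (induction \<phi>) (simp_all add: avars_body_index)
  then show "less_free \<phi>" "iteration_bodies_less_free \<phi>" "bound_vars \<phi> = []" "parameters \<phi> \<subseteq> {i}"
    by blast+
qed

lemma avars_AVar [simp]: "avars (AVar x) = {x}"
proof -
  have "\<exists>(\<rho> :: nat \<Rightarrow> int) v. v \<noteq> \<rho> x"
    by (intro exI[of _ "\<lambda>_. 0 :: int"] exI[of _ 1]) simp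
  then show ?thesis by (auto simp: avars_def)
qed

lemma avars_constant [simp]: "avars Zero = {}" "avars (Succ Zero) = {}"
  by (simp_all add: avars_def)

lemma iteration_simps:
  assumes "Ch_body i \<phi>"
  shows "iteration_bodies_less_free (iteration i \<phi>)" "bound_vars (iteration i \<phi>) = [i]"
    "parameters (iteration i \<phi>) = {0}" "Ch_shape 0 (iteration i \<phi>)"
  using Ch_bodyD[OF assms] assms by (auto simp: iteration_def aeq_def)

lemma Ch_body_program_body: "Ch_body 1 (program_body rs Q A)"
  by (auto simp: program_body_def Ch_body_successors[unfolded One_nat_def])

lemma in_Ch: "And (program_schema rs Q A) (input_schema x) \<in> Ch"
proof -
  have "Ch_body 2 (And (imp (prv 2 origin) (And (here 2 (psym End)) (here 2 (pst (Pre x))))) (prelude_body x))"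
    using Ch_body_prelude_body by simp
  note b = iteration_simps[OF this] iteration_simps[OF Ch_body_program_body[of rs Q A]]
  then have "wf_schema (And (program_schema rs Q A) (input_schema x))"
    "parameters (And (program_schema rs Q A) (input_schema x)) \<subseteq> {0}"
    "Ch_shape 0 (And (program_schema rs Q A) (input_schema x))"
    by (simp_all add: wf_schema_def program_schema_def input_schema_def aeq_def)
  then show ?thesis unfolding Ch_def by blast
qed

text \<open>Ensures that every admissible interpretation gives the upper bound of the iterations a
  natural value.\<close>

lemma zero_in_parameters: "0 \<in> parameters (And (program_schema rs Q A) \<psi>)"
  by (simp add: program_schema_def)

section \<open>Models of the schema and runs of the machine\<close>

lemma holds_iff:
  "holds \<rho> I (And (program_schema rs Q A) (input_schema x)) \<longleftrightarrow>
    I origin 0 \<and> \<not> I halt 0 \<and> I halt (\<rho> 0) \<and>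
    (\<forall>i\<in>{1..\<rho> 0}. \<forall>a\<in>set Q. \<forall>x\<in>set A. I (pst a) i \<longrightarrow> I (psym x) i \<longrightarrow> \<not> I halt i \<and>
      (\<exists>q y z. (a, x, q, y, z) \<in> set rs \<and>
        I (pst q) (i + 1) \<and> I (psym y) (2 * i) \<and> I (psym z) (2 * i + 1))) \<and>
    (\<forall>i\<in>{1..\<rho> 0}. I origin (i - 1) \<longrightarrow> I (psym End) i \<and> I (pst (Pre x)) i) \<and>
    (\<forall>i\<in>{1..\<rho> 0}. \<forall>k<x. I (pst (Pre (Suc k))) i \<longrightarrow> I (pst (Pre k)) (i + 1) \<and> \<not> I halt i \<and>
      I (psym (Reg 0)) (2 * i + 1) \<and> (I (psym End) i \<longrightarrow> I (psym End) (2 * i)) \<and>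
      (I (psym (Reg 0)) i \<longrightarrow> I (psym (Reg 0)) (2 * i)))"
proof -
  have "holds \<rho> I (iteration 1 (program_body rs Q A)) \<longleftrightarrow>
    (\<forall>i\<in>{1..\<rho> 0}. \<forall>a\<in>set Q. \<forall>x\<in>set A. I (pst a) i \<longrightarrow> I (psym x) i \<longrightarrow> \<not> I halt i \<and>
      (\<exists>q y z. (a, x, q, y, z) \<in> set rs \<and>
        I (pst q) (i + 1) \<and> I (psym y) (2 * i) \<and> I (psym z) (2 * i + 1)))"
    unfolding iteration_def program_body_def
    by (simp add: holds_successors split_def del: One_nat_def)
  moreover have "holds \<rho> I (input_schema x) \<longleftrightarrow>
    (\<forall>i\<in>{1..\<rho> 0}. I origin (i - 1) \<longrightarrow> I (psym End) i \<and> I (pst (Pre x)) i) \<and>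
    (\<forall>i\<in>{1..\<rho> 0}. \<forall>k<x. I (pst (Pre (Suc k))) i \<longrightarrow> I (pst (Pre k)) (i + 1) \<and> \<not> I halt i \<and>
      I (psym (Reg 0)) (2 * i + 1) \<and> (I (psym End) i \<longrightarrow> I (psym End) (2 * i)) \<and>
      (I (psym (Reg 0)) i \<longrightarrow> I (psym (Reg 0)) (2 * i)))"
    unfolding iteration_def input_schema_def
    by (simp add: holds_prelude_body prelude_clause_def copy_clauses_def) blast
  ultimately show ?thesis
    by (simp only: program_schema_def holds.simps aval.simps conj_ac)
qed

text \<open>Turns a run into the sequences from which a model is read off: \<open>S i\<close> is the
  state before step \<open>i\<close>, \<open>T i\<close> the \<open>i\<close>-th symbol ever
  queued.\<close>

lemma run_trace:
  assumes "((a0, [x0]), (a, w)) \<in> (qstep M)\<^sup>*"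
  shows "\<exists>m S T. 1 \<le> m \<and> S 1 = a0 \<and> T 1 = x0 \<and> S m = a \<and> w = map T [m..<2 * m] \<and>
    (\<forall>i. 1 \<le> i \<and> i < m \<longrightarrow> (S i, T i, S (Suc i), T (2 * i), T (Suc (2 * i))) \<in> M)"
  using assms
proof (induction "(a, w)" arbitrary: a w rule: rtrancl_induct)
  case base
  show ?case by (intro exI[of _ 1] exI[of _ "\<lambda>_. a0"] exI[of _ "\<lambda>_. x0"])
      (simp add: numeral_2_eq_2)
next
  case (step c)
  obtain b v where c: "c = (b, v)" by fastforce
  from step.hyps(3)[OF c] obtain m S T where m: "1 \<le> m" and ST: "S 1 = a0" "T 1 = x0" "S m = b"
    "v = map T [m..<2 * m]"
    "\<And>i. 1 \<le> i \<Longrightarrow> i < m \<Longrightarrow> (S i, T i, S (Suc i), T (2 * i), T (Suc (2 * i))) \<in> M" by blast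
  from step.hyps(2) c obtain x u y z where u: "v = x # u" "w = u @ [y, z]" "(b, x, a, y, z) \<in> M"
    by (auto elim: qstepE)
  have v: "v = T m # map T [Suc m..<2 * m]"
    using ST(4) m by (simp add: upt_conv_Cons)
  define S' where "S' = S(Suc m := a)"
  define T' where "T' = T(2 * m := y, Suc (2 * m) := z)"
  have low: "T' i = T i" if "i < 2 * m" for i
    using that by (simp add: T'_def)
  have "map T [Suc m..<2 * m] = map T' [Suc m..<2 * m]"
    by (rule map_cong) (simp_all add: low)
  with u(1) v have "u = map T' [Suc m..<2 * m]" by (metis list.inject)
  with u(2) have "w = map T' [Suc m..<2 * m] @ [y, z]" by (simp only:)
  also have "\<dots> = map T' [Suc m..<2 * Suc m]"
    using m by (simp add: T'_def)
  finally have w: "w = map T' [Suc m..<2 * Suc m]" .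
  have "(S' i, T' i, S' (Suc i), T' (2 * i), T' (Suc (2 * i))) \<in> M" if i: "1 \<le> i" "i < Suc m" for i
  proof (cases "i = m")
    case True
    then show ?thesis using u v m ST(3) low[of m] by (simp add: S'_def T'_def)
  next
    case False
    then have "i < m" using i by simp
    then show ?thesis
      using ST(5)[OF i(1)] low[of i] low[of "2 * i"] low[of "Suc (2 * i)"] by (simp add: S'_def)
  qed
  moreover have "S' 1 = a0" "T' 1 = x0" "S' (Suc m) = a"
    using m ST(1,2) low[of 1] by (simp_all add: S'_def)
  ultimately show ?case
    using w by (intro exI[of _ "Suc m"] exI[of _ S'] exI[of _ T']) simp
qed

text \<open>\<open>Q\<close> lists the source states of the program rules. The halting state is not
  among them, so the end of an accepting run violates no step clause; the states
  \<open>Pre (Suc k)\<close> are left to the input clauses.\<close>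

locale queue_machine =
  fixes rs :: "rule list" and Q :: "st list" and A :: "sym list"
  assumes rules_closed: "(a, x, b, y, z) \<in> set rs \<Longrightarrow>
      a \<in> set Q \<and> b \<in> insert (St 0) (set Q) \<and> x \<in> set A \<and> y \<in> set A \<and> z \<in> set A"
    and Pre_0: "Pre 0 \<in> set Q" and halt_not_source: "St 0 \<notin> set Q"
    and Pre_Suc: "Pre (Suc k) \<notin> set Q" and End_Reg_0: "End \<in> set A" "Reg 0 \<in> set A"
begin

text \<open>A model need not mark an index with a unique state or symbol; it is only required that
  the atoms of one reachable configuration be true. In a pending input state the word must avoid
  blanks, for which there is no input clause.\<close>

definition invariant :: "nat \<Rightarrow> (nat \<Rightarrow> int \<Rightarrow> bool) \<Rightarrow> nat \<Rightarrow> st \<Rightarrow> sym list \<Rightarrow> bool" where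
  "invariant x I i a w \<longleftrightarrow>
     ((Pre x, [End]), (a, w)) \<in> (qstep (set rs \<union> prelude x))\<^sup>* \<and>
     length w = i \<and> I (pst a) (int i) \<and> (\<forall>j<i. I (psym (w ! j)) (int (i + j))) \<and>
     set w \<subseteq> set A \<and>
     (a \<in> insert (St 0) (set Q) \<or> (\<exists>k<x. a = Pre (Suc k) \<and> set w \<subseteq> {End, Reg 0}))"

lemma invariant_step:
  assumes inv: "invariant x I i a w" and i: "1 \<le> i" "int i \<le> \<rho> 0" and a: "a \<noteq> St 0"
    and holds: "holds \<rho> I (And (program_schema rs Q A) (input_schema x))"
  shows "\<not> I halt (int i) \<and> (\<exists>b w'. invariant x I (Suc i) b w')"
proof -
  let ?M = "set rs \<union> prelude x"
  from inv i obtain s u where w: "w = s # u" by (cases w) (auto simp: invariant_def)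
  with inv i have facts: "I (pst a) (int i)" "I (psym s) (int i)" "int i \<in> {1..\<rho> 0}"
    by (auto simp: invariant_def dest: spec[of _ 0])
  have next_inv: "invariant x I (Suc i) b (u @ [y, z])"
    if rule: "(a, s, b, y, z) \<in> ?M" and I: "I (pst b) (int i + 1)" "I (psym y) (2 * int i)"
      "I (psym z) (2 * int i + 1)" and "set (u @ [y, z]) \<subseteq> set A" and
      "b \<in> insert (St 0) (set Q) \<or> (\<exists>k<x. b = Pre (Suc k) \<and> set (u @ [y, z]) \<subseteq> {End, Reg 0})"
    for b y z
  proof -
    have "I (psym ((u @ [y, z]) ! j)) (int (Suc i + j))" if "j < Suc i" for j
    proof -
      have len: "Suc (length u) = i" using inv w by (simp add: invariant_def)
      \<comment> \<open>Old symbols move one place forward while the step number grows by one, so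
        their indices stay; the new ones get \<open>2 * i\<close> and \<open>2 * i + 1\<close>
        because the old word has length \<open>i\<close>.\<close>
      consider "j < length u" | "j = length u" | "j = Suc (length u)" using \<open>j < Suc i\<close> len by linarith
      then show ?thesis
      proof cases
        case 1
        then have "I (psym (w ! Suc j)) (int (i + Suc j))" using inv len unfolding invariant_def by auto
        with 1 w show ?thesis by (simp add: nth_append)
      next
        case 2
        with len have at: "int (Suc i + j) = 2 * int i" "(u @ [y, z]) ! j = y" by simp_all
        show ?thesis unfolding at by (rule I(2))
      next
        case 3
        with len have at: "int (Suc i + j) = 2 * int i + 1" "(u @ [y, z]) ! j = z"
          by (simp_all add: nth_append)
        show ?thesis unfolding at by (rule I(3))
      qed
    qed
    moreover have "((Pre x, [End]), (b, u @ [y, z])) \<in> (qstep ?M)\<^sup>*"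
      using inv qstepI[OF rule, of u] w by (auto simp: invariant_def intro: rtrancl_into_rtrancl)
    ultimately show ?thesis
      using that inv w by (auto simp: invariant_def add.commute)
  qed
  from inv a consider (program) "a \<in> set Q" | (prelude) k where "k < x" "a = Pre (Suc k)" "set w \<subseteq> {End, Reg 0}"
    unfolding invariant_def by blast
  then show ?thesis
  proof cases
    case program
    from inv w have "s \<in> set A" "set u \<subseteq> set A" by (auto simp: invariant_def)
    with holds[unfolded holds_iff] program facts obtain b y z where
      "\<not> I halt (int i)" and b: "(a, s, b, y, z) \<in> set rs" "I (pst b) (int i + 1)"
        "I (psym y) (2 * int i)" "I (psym z) (2 * int i + 1)" by blast
    moreover have "invariant x I (Suc i) b (u @ [y, z])"
      using b rules_closed[OF b(1)] \<open>set u \<subseteq> set A\<close> by (intro next_inv) auto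
    ultimately show ?thesis by blast
  next
    case prelude
    have *: "I (pst (Pre k)) (int i + 1) \<and> \<not> I halt (int i) \<and>
      I (psym (Reg 0)) (2 * int i + 1) \<and> (I (psym End) (int i) \<longrightarrow> I (psym End) (2 * int i)) \<and>
      (I (psym (Reg 0)) (int i) \<longrightarrow> I (psym (Reg 0)) (2 * int i))"
      using holds[unfolded holds_iff] prelude(1,2) facts(1,3) by blast
    have s: "s \<in> {End, Reg 0}" "set (u @ [s, Reg 0]) \<subseteq> {End, Reg 0}" using prelude(3) w by auto
    then have "I (psym s) (2 * int i)" using facts(2) * by auto
    moreover have "Pre k \<in> set Q \<or> (\<exists>k'<x. Pre k = Pre (Suc k'))"
      using prelude(1) Pre_0 by (cases k) auto
    moreover have "(a, s, Pre k, s, Reg 0) \<in> ?M"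
      using prelude(1,2) s(1) by (auto simp: prelude_def)
    moreover have "set (u @ [s, Reg 0]) \<subseteq> set A" using s(2) End_Reg_0 by auto
    ultimately have "invariant x I (Suc i) (Pre k) (u @ [s, Reg 0])"
      using * s(2) by (intro next_inv) blast+
    with * show ?thesis by blast
  qed
qed

text \<open>If no run accepts, the invariant is carried to index \<open>n\<close> without meeting
  the halting state, and the step clause at \<open>n\<close> then denies the very atom asserted
  there.\<close>

lemma accepts_if_satisfiable:
  assumes "satisfiable (And (program_schema rs Q A) (input_schema x))"
  shows "accepts (set rs) x"
proof (rule ccontr)
  assume "\<not> accepts (set rs) x"
  then have not_halt: "a \<noteq> St 0" if "invariant x I i a w" for I i a w
    using that by (auto simp: accepts_def invariant_def)
  from assms obtain \<rho> I where "\<rho> 0 \<in> \<nat>" and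
    holds: "holds \<rho> I (And (program_schema rs Q A) (input_schema x))"
    using zero_in_parameters unfolding satisfiable_def by blast
  then obtain n where n: "\<rho> 0 = int n" by (auto elim: Nats_cases)
  note H = holds[unfolded holds_iff n]
  then have "n \<noteq> 0" by (intro notI) simp
  have reached: "1 \<le> i \<longrightarrow> i \<le> n \<longrightarrow> (\<exists>a w. invariant x I i a w)" for i
  proof (induction i)
    case (Suc i)
    show ?case
    proof (cases "i = 0")
      case True
      have "(1::int) \<in> {1..int n}" using \<open>n \<noteq> 0\<close> by simp
      then have "I (psym End) 1 \<and> I (pst (Pre x)) 1" using H by fastforce
      moreover have "Pre x \<in> set Q \<or> (\<exists>k<x. Pre x = Pre (Suc k))"
        using Pre_0 by (cases x) auto
      ultimately have "invariant x I 1 (Pre x) [End]"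
        using End_Reg_0 by (auto simp: invariant_def)
      then show ?thesis using True by auto
    next
      case False
      then show ?thesis
        using Suc invariant_step[of x I i _ _ \<rho>] not_halt holds n by fastforce
    qed
  qed simp
  from reached[of n] \<open>n \<noteq> 0\<close> obtain a w where "invariant x I n a w" by auto
  from invariant_step[OF this _ _ not_halt[OF this] holds] \<open>n \<noteq> 0\<close> n have "\<not> I halt (int n)" by auto
  with H show False by blast
qed

lemma satisfiable_if_accepts:
  assumes "accepts (set rs) x"
  shows "satisfiable (And (program_schema rs Q A) (input_schema x))"
proof -
  from assms obtain w where "((Pre x, [End]), (St 0, w)) \<in> (qstep (set rs \<union> prelude x))\<^sup>*"
    unfolding accepts_def by blast
  from run_trace[OF this] obtain m S T where m: "1 \<le> m" and ST: "S 1 = Pre x" "T 1 = End" "S m = St 0" and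
    rule: "\<And>i. 1 \<le> i \<Longrightarrow> i < m \<Longrightarrow>
      (S i, T i, S (Suc i), T (2 * i), T (Suc (2 * i))) \<in> set rs \<union> prelude x"
    by blast
  \<comment> \<open>Each positive index carries one state atom and one symbol atom; index
    \<open>0\<close> carries only \<open>origin\<close>, so \<open>origin\<close> at
    \<open>i - 1\<close> singles out \<open>i = 1\<close>.\<close>
  define I where "I p \<alpha> \<longleftrightarrow> (p = origin \<and> \<alpha> = 0) \<or> (\<alpha> \<ge> 1 \<and> (p = pst (S (nat \<alpha>)) \<or> p = psym (T (nat \<alpha>))))"
    for p and \<alpha> :: int
  have I: "I (pst a) (int i) \<longleftrightarrow> i \<ge> 1 \<and> a = S i" "I (psym y) (int i) \<longleftrightarrow> i \<ge> 1 \<and> y = T i"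
    "I origin (int i) \<longleftrightarrow> i = 0" for a y i
    by (auto simp: I_def)
  have source: "S i \<noteq> St 0" if "1 \<le> i" "i < m" for i
    using rule[OF that] rules_closed halt_not_source by (fastforce simp: prelude_def)
  define \<rho> :: "nat \<Rightarrow> int" where "\<rho> = (\<lambda>_. int m)"
  have "holds \<rho> I (And (program_schema rs Q A) (input_schema x))"
    unfolding holds_iff
  proof (intro conjI ballI allI impI)
    show "I origin 0" "\<not> I halt 0" "I halt (\<rho> 0)"
      using I(3)[of 0] I(1)[of _ 0] I(1)[of "St 0" m] ST m by (simp_all add: \<rho>_def)
  next
    fix i assume "i \<in> {1..\<rho> 0}"
    then have "i = int (nat i)" "1 \<le> nat i" "nat i \<le> m" by (auto simp: \<rho>_def)
    then obtain j where j: "i = int j" "1 \<le> j" "j \<le> m" by blast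
    have ints: "i + 1 = int (Suc j)" "2 * i = int (2 * j)" "2 * i + 1 = int (Suc (2 * j))"
      "i - 1 = int (j - 1)"
      using j by simp_all
    { fix a y assume a: "a \<in> set Q" and y: "y \<in> set A" and "I (pst a) i" "I (psym y) i"
      then have eq: "a = S j" "y = T j" by (simp_all add: j I)
      \<comment> \<open>\<open>Q\<close> omits the halting state reached at \<open>m\<close>, so a
        step clause is triggered only before \<open>m\<close>, where the trace supplies a
        rule.\<close>
      with a halt_not_source ST(3) have "j < m" using j by (cases "j = m") auto
      then show "\<not> I halt i" using source[of j] j I(1)[of "St 0" j] by auto
      have "(S j, T j, S (Suc j), T (2 * j), T (Suc (2 * j))) \<in> set rs"
        using rule[of j] j \<open>j < m\<close> a eq(1) Pre_Suc by (auto simp: prelude_def)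
      moreover have "I (pst (S (Suc j))) (i + 1)" "I (psym (T (2 * j))) (2 * i)"
        unfolding ints(1,2) I using j by simp_all
      moreover have "I (psym (T (Suc (2 * j)))) (2 * i + 1)"
        unfolding ints(3) I by simp
      ultimately show "\<exists>q y' z. (a, y, q, y', z) \<in> set rs \<and> I (pst q) (i + 1) \<and> I (psym y') (2 * i) \<and>
          I (psym z) (2 * i + 1)"
        unfolding eq by blast }
    { assume "I origin (i - 1)"
      then have "j = 1" unfolding ints I using j by simp
      with ST(1,2) show "I (psym End) i" "I (pst (Pre x)) i"
        unfolding j(1) I by simp_all }
    { fix k assume "k < x" and "I (pst (Pre (Suc k))) i"
      then have eq: "S j = Pre (Suc k)" by (simp add: j I)
      with ST(3) have "j < m" using j by (cases "j = m") auto
      then show "\<not> I halt i" using source[of j] j I(1)[of "St 0" j] by auto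
      have "(S j, T j, S (Suc j), T (2 * j), T (Suc (2 * j))) \<in> prelude x"
        using rule[of j] j \<open>j < m\<close> eq rules_closed Pre_Suc by fastforce
      then have next_eq: "S (Suc j) = Pre k" "T (2 * j) = T j" "T (Suc (2 * j)) = Reg 0"
        using eq by (auto simp: prelude_def)
      show "I (pst (Pre k)) (i + 1)" "I (psym (Reg 0)) (2 * i + 1)"
        unfolding ints(1,3) I using next_eq by simp_all
      have double: "I (psym y) (2 * i)" if "I (psym y) i" for y
      proof -
        from that have "y = T j" unfolding j(1) I by simp
        then show ?thesis unfolding ints(2) I using next_eq(2) j(2) by simp
      qed
      show "I (psym End) i \<Longrightarrow> I (psym End) (2 * i)" "I (psym (Reg 0)) i \<Longrightarrow> I (psym (Reg 0)) (2 * i)"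
        by (simp_all add: double) }
  qed
  then show ?thesis unfolding satisfiable_def by (intro exI[of _ \<rho>] exI[of _ I]) (simp add: \<rho>_def)
qed

end

section \<open>Recursiveness of the encoding\<close>

text \<open>Spares the closure lemmas for codes the handling of \<open>None\<close>.\<close>

definition total_recursive :: "nat \<Rightarrow> (nat list \<Rightarrow> nat) \<Rightarrow> bool" where
  "total_recursive n h \<longleftrightarrow>
     (\<exists>f. partial_recursive n f \<and> (\<forall>xs. length xs = n \<longrightarrow> f xs = Some (h xs)))"

lemma total_recursiveI:
  "partial_recursive n f \<Longrightarrow> (\<And>xs. length xs = n \<Longrightarrow> f xs = Some (h xs)) \<Longrightarrow> total_recursive n h"
  unfolding total_recursive_def by blast

lemma total_recursive_cong:
  "(\<And>xs. length xs = n \<Longrightarrow> h xs = h' xs) \<Longrightarrow> total_recursive n h \<longleftrightarrow> total_recursive n h'"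
  unfolding total_recursive_def by auto

lemma total_recursive_proj: "i < n \<Longrightarrow> total_recursive n (\<lambda>xs. xs ! i)"
  by (rule total_recursiveI[OF partial_recursive.proj]) simp_all

lemma total_recursive_comp:
  assumes h: "total_recursive (length gs) h" and gs: "\<forall>g\<in>set gs. total_recursive n g"
  shows "total_recursive n (\<lambda>xs. h (map (\<lambda>g. g xs) gs))"
proof -
  obtain f where f: "partial_recursive (length gs) f"
    "\<And>xs. length xs = length gs \<Longrightarrow> f xs = Some (h xs)"
    using h unfolding total_recursive_def by blast
  obtain G where G: "\<And>g. g \<in> set gs \<Longrightarrow> partial_recursive n (G g)"
    "\<And>g xs. g \<in> set gs \<Longrightarrow> length xs = n \<Longrightarrow> G g xs = Some (g xs)"
    using gs unfolding total_recursive_def by metis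
  have "those (map (\<lambda>g. g xs) (map G gs)) = Some (map (\<lambda>g. g xs) gs)" if "length xs = n" for xs
    using G(2)[OF _ that] by (induction gs) auto
  then show ?thesis
    using f G(1)
    by (intro total_recursiveI[OF partial_recursive.comp[of "map G gs" f n]]) auto
qed

lemma total_recursive_comp1:
  assumes "total_recursive 1 (\<lambda>xs. h (xs ! 0))" "total_recursive n g"
  shows "total_recursive n (\<lambda>xs. h (g xs))"
  using total_recursive_comp[of "[g]" "\<lambda>xs. h (xs ! 0)" n] assms by simp

lemma total_recursive_comp2:
  assumes "total_recursive 2 (\<lambda>xs. h (xs ! 0) (xs ! 1))" "total_recursive n g" "total_recursive n g'"
  shows "total_recursive n (\<lambda>xs. h (g xs) (g' xs))"
  using total_recursive_comp[of "[g, g']" "\<lambda>xs. h (xs ! 0) (xs ! 1)" n] assms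
  by (simp add: numeral_2_eq_2)

lemma total_recursive_Suc:
  assumes "total_recursive n g"
  shows "total_recursive n (\<lambda>xs. Suc (g xs))"
  by (rule total_recursive_comp1[OF total_recursiveI[OF partial_recursive.succ] assms]) simp

lemma total_recursive_const: "total_recursive n (\<lambda>xs. c)"
proof (induction c)
  case 0
  show ?case by (rule total_recursiveI[OF partial_recursive.zero]) simp
qed (rule total_recursive_Suc)

lemma total_recursive_prec:
  assumes f: "total_recursive n (h 0)"
    and g: "total_recursive (Suc (Suc n)) g"
    and h: "\<And>k xs. length xs = n \<Longrightarrow> h (Suc k) xs = g (k # h k xs # xs)"
  shows "total_recursive (Suc n) (\<lambda>xs. h (hd xs) (tl xs))"
proof -
  obtain f' where f': "partial_recursive n f'" "\<And>xs. length xs = n \<Longrightarrow> f' xs = Some (h 0 xs)"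
    using f unfolding total_recursive_def by blast
  obtain g' where g': "partial_recursive (Suc (Suc n)) g'"
    "\<And>xs. length xs = Suc (Suc n) \<Longrightarrow> g' xs = Some (g xs)"
    using g unfolding total_recursive_def by blast
  have "primitive_recursion f' g' k xs = Some (h k xs)" if "length xs = n" for k xs
    using that by (induction k) (simp_all add: f' g' h)
  then show ?thesis
    by (intro total_recursiveI[OF partial_recursive.prec[OF f'(1) g'(1)]]) simp
qed

lemma total_recursive_nat_rec:
  assumes g: "total_recursive 2 (\<lambda>xs. g (xs ! 0) (xs ! 1))" and h: "\<And>k. h (Suc k) = g k (h k)"
  shows "total_recursive 1 (\<lambda>xs. h (xs ! 0))"
proof -
  have "total_recursive (Suc 0) (\<lambda>xs. (\<lambda>k _. h k) (hd xs) (tl xs))"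
  proof (rule total_recursive_prec[where g = "\<lambda>xs. g (xs ! 0) (xs ! 1)"])
    show "total_recursive 0 (\<lambda>_. h 0)" by (rule total_recursive_const)
    show "total_recursive (Suc (Suc 0)) (\<lambda>xs. g (xs ! 0) (xs ! 1))"
      using g by (simp add: numeral_2_eq_2)
  qed (simp add: h)
  then show ?thesis
    by (subst total_recursive_cong[where h' = "\<lambda>xs. h (hd xs)"]) (auto simp: hd_conv_nth length_Suc_conv)
qed

lemma total_recursive_add:
  assumes "total_recursive n g" "total_recursive n g'"
  shows "total_recursive n (\<lambda>xs. g xs + g' xs)"
proof (rule total_recursive_comp2[OF _ assms])
  have "total_recursive (Suc 1) (\<lambda>xs. (\<lambda>k ys. k + ys ! 0) (hd xs) (tl xs))"
  proof (rule total_recursive_prec[where g = "\<lambda>xs. Suc (xs ! 1)"])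
    show "total_recursive 1 (\<lambda>ys. 0 + ys ! 0)" by (simp add: total_recursive_proj)
    show "total_recursive (Suc (Suc 1)) (\<lambda>xs. Suc (xs ! 1))"
      by (intro total_recursive_Suc total_recursive_proj) simp
  qed simp
  then show "total_recursive 2 (\<lambda>xs. xs ! 0 + xs ! 1)"
    by (subst total_recursive_cong[where h' = "\<lambda>xs. hd xs + tl xs ! 0"])
      (auto simp: numeral_2_eq_2 length_Suc_conv)
qed

lemma total_recursive_triangle:
  assumes "total_recursive n g"
  shows "total_recursive n (\<lambda>xs. triangle (g xs))"
proof (rule total_recursive_comp1[OF total_recursive_nat_rec assms])
  show "total_recursive 2 (\<lambda>xs. (\<lambda>k r. r + Suc k) (xs ! 0) (xs ! 1))"
    by (intro total_recursive_add total_recursive_Suc total_recursive_proj) simp_all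
qed simp

text \<open>The pairing is Cantor's, \<open>prod_encode (a, b) = triangle (a + b) + a\<close>, so
  addition and triangular numbers suffice.\<close>

lemma total_recursive_prod_encode:
  assumes "total_recursive n g" "total_recursive n g'"
  shows "total_recursive n (\<lambda>xs. prod_encode (g xs, g' xs))"
  unfolding prod_encode_def prod.case
  by (intro total_recursive_add total_recursive_triangle assms)

lemmas total_recursive_intros =
  total_recursive_const total_recursive_proj total_recursive_Suc total_recursive_prod_encode

lemma total_recursive_prelude_body: "total_recursive 1 (\<lambda>xs. schema_code (prelude_body (xs ! 0)))"
proof (rule total_recursive_nat_rec)
  \<comment> \<open>\<open>5\<close> is the tag of \<open>And\<close> in
    \<open>schema_code\<close>.\<close>
  show "total_recursive 2 (\<lambda>xs. (\<lambda>k r. prod_encode (5, prod_encode (r, schema_code (prelude_clause k))))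
      (xs ! 0) (xs ! 1))"
    unfolding prelude_clause_def here_def nxt_def pst.simps schema_code.simps
    by (intro total_recursive_intros) simp_all
qed simp

lemma total_recursive_input_schema: "total_recursive 1 (\<lambda>xs. schema_code (input_schema (xs ! 0)))"
  unfolding input_schema_def iteration_def here_def pst.simps schema_code.simps
  by (intro total_recursive_intros total_recursive_prelude_body) simp_all

section \<open>Diagonalisation\<close>

theorem theorem6p2:
  "\<not> recursively_enumerable (schema_code ` {\<phi> \<in> Ch. unsatisfiable \<phi>})"
proof
  assume "recursively_enumerable (schema_code ` {\<phi> \<in> Ch. unsatisfiable \<phi>})"
  then obtain f where f: "partial_recursive 1 f"
    "schema_code ` {\<phi> \<in> Ch. unsatisfiable \<phi>} = {x. f [x] \<noteq> None}"
    unfolding recursively_enumerable_def by blast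
  \<comment> \<open>If \<open>x\<close> is the code of \<open>\<phi>\<close>, then
    \<open>red x\<close> is the code of \<open>And \<phi> (input_schema x)\<close>. The first
    conjunct is passed on as a number, so nothing has to be decoded.\<close>
  define red where "red x = prod_encode (5, prod_encode (x, schema_code (input_schema x)))" for x
  have "total_recursive 1 (\<lambda>xs. red (xs ! 0))"
    unfolding red_def by (intro total_recursive_intros total_recursive_input_schema) simp
  then obtain r where r: "partial_recursive 1 r" "r [x] = Some (red x)" for x
    unfolding total_recursive_def by force
  \<comment> \<open>\<open>F\<close> is defined at \<open>x\<close> exactly if \<open>red x\<close>
    codes an unsatisfiable schema of the class.\<close>
  define F where "F = (\<lambda>xs. Option.bind (those (map (\<lambda>g. g xs) [r])) f)"
  have "partial_recursive 1 F"
    unfolding F_def using r(1) f(1) by (intro partial_recursive.comp) simp_all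
  \<comment> \<open>Input in register \<open>0\<close>, where the machine loads it, output in
    \<open>1\<close>, scratch from \<open>2\<close>.\<close>
  from computable_atD[OF partial_recursive_computable_at[OF this], of "[0]" 2 1]
  obtain c where c: "computes c F [0] 1 2" by auto
  have terminates: "(\<exists>t. ((\<lambda>_. 0)(0 := x), t) \<in> sem c) \<longleftrightarrow> f [red x] \<noteq> None" for x
    using computesD[OF c, of "(\<lambda>_. 0)(0 := x)"] by (auto simp: F_def r(2))

  obtain R where R: "R > 0" "regs_below R c" using ex_regs_below by blast
  have "finite (program_rules R c)" "finite (alphabet R)"
    by (simp_all add: program_rules_def finite_rules_of pass_def alphabet_def)
  then obtain rs A where rs: "set rs = program_rules R c" and A: "set A = alphabet R"
    using finite_list by metis
  \<comment> \<open>The source states: \<open>St 1\<close> is the entry, \<open>St 2\<close> to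
    \<open>St (1 + fresh c)\<close> are the inner states, and \<open>St 0\<close> is left
    out.\<close>
  define Q where "Q = Pre 0 # map St [1..<2 + fresh c]"
  interpret queue_machine rs Q A
  proof
    fix a x b y z
    assume "(a, x, b, y, z) \<in> set rs"
    then consider "(a, x, b, y, z) \<in> pass (alphabet R) (Pre 0) (St 1)"
      | "(a, x, b, y, z) \<in> rules_of R c (St 1) (St 0) 2"
      unfolding rs program_rules_def by blast
    then show "a \<in> set Q \<and> b \<in> insert (St 0) (set Q) \<and> x \<in> set A \<and> y \<in> set A \<and> z \<in> set A"
    proof cases
      case 1
      then show ?thesis by (auto simp: pass_def alphabet_def Q_def A)
    next
      case 2
      from rules_of_states[OF this] rules_of_symbols[OF this R(2)] show ?thesis
        by (auto simp: Q_def A)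
    qed
  qed (use R(1) in \<open>auto simp: Q_def A alphabet_def\<close>)

  \<comment> \<open>The diagonal step: the program is run on its own code.\<close>
  define x where "x = schema_code (program_schema rs Q A)"
  let ?\<phi> = "And (program_schema rs Q A) (input_schema x)"
  \<comment> \<open>Satisfiability means that the program for \<open>F\<close> halts on
    \<open>x\<close>, hence that the enumeration contains \<open>red x\<close>, the code of
    \<open>?\<phi>\<close> itself.\<close>
  have "satisfiable ?\<phi> \<longleftrightarrow> f [red x] \<noteq> None"
    using accepts_if_satisfiable satisfiable_if_accepts accepts_program_rules_iff[OF R(2,1)]
      terminates unfolding rs by blast
  also have "\<dots> \<longleftrightarrow> schema_code ?\<phi> \<in> schema_code ` {\<phi> \<in> Ch. unsatisfiable \<phi>}"
    unfolding f(2) by (simp add: red_def x_def)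
  also have "\<dots> \<longleftrightarrow> unsatisfiable ?\<phi>"
    using in_Ch by (auto simp: schema_code_inject simp del: schema_code.simps)
  finally show False by blast
qed

end
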